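(* The entropy of the grim reaper $\Gamma^1\subset \mathbf{R}^2$ is $2$, i.e. $\lambda(\Gamma^1)=2$.
   Context: The grim reaper is the curve $\Gamma^1=\{(x,-\log\cos x): x\in(-\pi/2,\pi/2)\}\subset\mathbf{R}^2$. For a hypersurface $\Sigma^n\subset\mathbf{R}^{n+1}$, $z_0\in\mathbf{R}^{n+1}$ and $t_0>0$, the $F$-functional is $F_{z_0,t_0}(\Sigma)=(4\pi t_0)^{-n/2}\int_\Sigma e^{-|x-z_0|^2/(4t_0)}\,d\mu$, where $d\mu$ is the $n$-dimensional area measure of $\Sigma$, and the entropy of $\Sigma$ is $\lambda(\Sigma)=\sup_{z_0,t_0}F_{z_0,t_0}(\Sigma)$, the supremum being over all $z_0\in\mathbf{R}^{n+1}$ and $t_0>0$. *)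

theory Defs
  imports "HOL-Analysis.Analysis"
begin

text \<open>Hausdorff outer measure, with the normalisation \<open>\<omega>\<^sub>n / 2\<^sup>n\<close> that makes it agree with
  the \<open>n\<close>-dimensional area on smooth \<open>n\<close>-dimensional submanifolds of Euclidean space.  Covering
  sets are required to be bounded because the library's \<^term>\<open>diameter\<close> is meaningful only for
  bounded sets; the empty set is treated separately because \<open>0 ^ 0 = 1\<close>, which matters for
  \<open>n = 0\<close>.\<close>

definition hausdorff_weight :: "nat \<Rightarrow> 'a::metric_space set \<Rightarrow> ennreal" where
  "hausdorff_weight n C =
     (if C = {} then 0 else ennreal (unit_ball_vol (real n) * (diameter C / 2) ^ n))"

definition hausdorff_outer :: "nat \<Rightarrow> 'a::metric_space set \<Rightarrow> ennreal" where
  "hausdorff_outer n A =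
     (SUP \<delta>\<in>{0::real<..}.
        INF C\<in>{C :: nat \<Rightarrow> 'a set.
                 A \<subseteq> (\<Union>i. C i) \<and> (\<forall>i. bounded (C i) \<and> diameter (C i) \<le> \<delta>)}.
          (\<Sum>i. hausdorff_weight n (C i)))"

text \<open>\<^const>\<open>hausdorff_outer\<close> is a metric outer measure, hence countably additive on the Borel
  sets, so \<^term>\<open>measure_of\<close> does not degenerate to the zero measure here.\<close>

definition hausdorff_measure :: "nat \<Rightarrow> 'a::metric_space measure" where
  "hausdorff_measure n = measure_of UNIV (sets borel) (hausdorff_outer n)"

text \<open>A hypersurface of the Euclidean space \<open>'a\<close> has dimension \<open>n = DIM('a) - 1\<close>, and its area
  measure is the \<open>n\<close>-dimensional Hausdorff measure restricted to it.  Both functionals take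
  values in \<^typ>\<open>ennreal\<close>, so divergent integrals and unbounded suprema are \<open>\<infinity>\<close>.\<close>

definition F_functional :: "'a::euclidean_space \<Rightarrow> real \<Rightarrow> 'a set \<Rightarrow> ennreal" where
  "F_functional z\<^sub>0 t\<^sub>0 \<Sigma> =
     (let n = DIM('a) - 1 in
        ennreal ((4 * pi * t\<^sub>0) powr (- real n / 2)) *
        (\<integral>\<^sup>+ x\<in>\<Sigma>. ennreal (exp (- (norm (x - z\<^sub>0))\<^sup>2 / (4 * t\<^sub>0))) \<partial>hausdorff_measure n))"

definition entropy :: "'a::euclidean_space set \<Rightarrow> ennreal" where
  "entropy \<Sigma> = (SUP z\<^sub>0. SUP t\<^sub>0\<in>{0<..}. F_functional z\<^sub>0 t\<^sub>0 \<Sigma>)"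

definition grim_reaper :: "(real ^ 2) set" where
  "grim_reaper = {vector [x, - ln (cos x)] | x. x \<in> {- pi / 2 <..< pi / 2}}"

end

theory Submission
  imports Defs "HOL-Probability.Distributions" "HOL-Real_Asymp.Real_Asymp"
begin

text \<open>The grim reaper moves by upward translation under curve shortening flow, so Huisken's
  monotonicity formula says that the \<open>F\<close>-functional centred at \<open>(a, b + s)\<close> with scale \<open>t + s\<close> is
  nondecreasing in \<open>s\<close>.  Seen from such a centre at that scale, the curve looks like two copies of
  a vertical line as \<open>s\<close> tends to infinity.  Quantitatively, the length element on the right half is
  \<open>sec x dx = dy + (cos x / (1 + sin x)) dx\<close> with \<open>y = - log cos x\<close>, so each half contributes at most
  a full Gaussian integral plus an error of order \<open>1 / sqrt (t + s)\<close>.  Hence all values are at most 2,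
  and the centres \<open>(0, t)\<close> with scale \<open>t\<close> show that 2 is approached as \<open>t\<close> tends to infinity.\<close>

section \<open>Hausdorff measure\<close>

text \<open>The splitting of the length element only gives 2 plus a positive error at each finite
  scale, so it cannot prove the bound alone; monotonicity carries it to scales where the error is
  negligible. The parameter s is time run backwards: lowering the curve by s is the same as raising
  the centre by s, and the translation is a motion by curvature because the curvature and the normal
  part of e_2 are both cos x. In the proof this becomes an explicit identity in x, b and t. The
  obstacle is the pair of infinite ends. Differentiation under the integral is done on compact arcs
  over [-c, c], where the divergence term leaves a boundary flux. The flux tends to 0 up the ends,
  uniformly for s in a bounded interval, so c can be enlarged after the final scale and the
  tolerated error have been fixed. Before any calculus can start, the Hausdorff measure has to be
  identified: it is a genuine Borel measure, and on an injective C^1 arc it is the speed times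
  Lebesgue measure.\<close>

text \<open>Caratheodory's criterion: it suffices to split a set \<open>A\<close> of finite outer
  measure along a closed \<open>F\<close>. The points of \<open>A\<close> at distance at least
  1/(N+1) from \<open>F\<close> are separated from \<open>A \<inter> F\<close>, so additivity holds
  for them. What is left of \<open>A - F\<close> lies in the shells \<open>R k\<close> with k \<ge>
  N, whose total outer measure is the tail of a convergent series.\<close>

lemma metric_outer_measure_borel:
  fixes m :: "'a::metric_space set \<Rightarrow> ennreal"
  assumes empty: "m {} = 0"
    and mono: "\<And>A B. A \<subseteq> B \<Longrightarrow> m A \<le> m B"
    and subadd: "\<And>A :: nat \<Rightarrow> 'a set. m (\<Union>i. A i) \<le> (\<Sum>i. m (A i))"
    and metric: "\<And>A B d. 0 < d \<Longrightarrow> (\<And>a b. a \<in> A \<Longrightarrow> b \<in> B \<Longrightarrow> d \<le> dist a b) \<Longrightarrow> m A + m B \<le> m (A \<union> B)"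
  shows "measure_space UNIV (sets borel) m"
proof -
  have subadd2: "m (A \<union> B) \<le> m A + m B" for A B
    using subadd[of "binaryset A B"] suminf_binaryset_eq[of m A B] empty
    by (simp add: UN_binaryset_eq)
  have closed_split: "m (A \<inter> F) + m (A - F) \<le> m A" if F: "closed F" "F \<noteq> {}" for A F
  proof (cases "m A = top")
    case False
    define D where "D k = {x \<in> A. 1 / (real k + 1) \<le> infdist x F}" for k
    define R where "R k = D (Suc k) - D k" for k
    have D_sub: "D k \<subseteq> A" for k by (auto simp: D_def)
    have R_sub: "R k \<subseteq> A" for k by (auto simp: D_def R_def)
    have sep: "1 / (real (Suc k) + 1) - 1 / (real l + 1) \<le> dist x y"
      if "x \<in> D (Suc k)" "y \<in> R l" for x y k l
      using that infdist_triangle[of x F y] by (auto simp: D_def R_def)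
    \<comment> \<open>Shells of the same parity are separated, so their outer measures add up.\<close>
    have alternating: "(\<Sum>i<N. m (R (2 * i + c))) \<le> m (\<Union>i<N. R (2 * i + c))" for N c
    proof (induction N)
      case (Suc N)
      have "m (\<Union>i<N. R (2 * i + c)) + m (R (2 * N + c)) \<le>
          m ((\<Union>i<N. R (2 * i + c)) \<union> R (2 * N + c))"
      proof (rule metric)
        \<comment> \<open>The natural gap is 1/(2N+c) - 1/(2N+c+1), but for 2N+c = 0 division by
          zero would make it negative. The shift by 1/2 gives a smaller gap that is positive in all
          cases.\<close>
        show "0 < 1 / (real (2 * N + c) + 1/2) - 1 / (real (2 * N + c) + 1)"
          using divide_strict_left_mono[of "real (2 * N + c) + 1/2" "real (2 * N + c) + 1" 1] by simp
        fix a b assume a: "a \<in> (\<Union>i<N. R (2 * i + c))" and b: "b \<in> R (2 * N + c)"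
        then obtain i where i: "i < N" "a \<in> D (Suc (2 * i + c))" by (auto simp: R_def)
        have "Suc (2 * i + c) + 1 \<le> 2 * N + c" using i by linarith
        then have "real (Suc (2 * i + c)) + 1 \<le> real (2 * N + c) + 1/2" by linarith
        then have "1 / (real (2 * N + c) + 1/2) \<le> 1 / (real (Suc (2 * i + c)) + 1)"
          by (intro divide_left_mono mult_pos_pos) auto
        then show "1 / (real (2 * N + c) + 1/2) - 1 / (real (2 * N + c) + 1) \<le> dist a b"
          using sep[OF i(2) b] by linarith
      qed
      also have "(\<Union>i<N. R (2 * i + c)) \<union> R (2 * N + c) = (\<Union>i<Suc N. R (2 * i + c))"
        by (auto simp: lessThan_Suc)
      finally have "m (\<Union>i<N. R (2 * i + c)) + m (R (2 * N + c)) \<le> m (\<Union>i<Suc N. R (2 * i + c))" .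
      from order_trans[OF add_right_mono[OF Suc] this] show ?case by (simp only: sum.lessThan_Suc)
    qed (simp add: empty)
    have bound: "(\<Sum>k<2 * N. m (R k)) \<le> 2 * m A" for N
    proof -
      have "(\<Sum>k<2 * N. m (R k)) = (\<Sum>i<N. m (R (2 * i + 0))) + (\<Sum>i<N. m (R (2 * i + 1)))"
        by (induction N) (simp_all add: ac_simps)
      also have "\<dots> \<le> m A + m A"
        by (intro add_mono order_trans[OF alternating] mono) (use R_sub in auto)
      finally show ?thesis by (simp add: mult_2)
    qed
    have "(\<Sum>k. m (R k)) \<le> 2 * m A"
    proof (rule suminf_le_const)
      fix n
      have "(\<Sum>k<n. m (R k)) \<le> (\<Sum>k<2 * n. m (R k))" by (intro sum_mono2) auto
      then show "(\<Sum>k<n. m (R k)) \<le> 2 * m A" using bound[of n] by simp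
    qed simp
    moreover have "2 * m A < top" using False by (simp add: ennreal_mult_less_top top.not_eq_extremum)
    ultimately have fin: "(\<Sum>k. m (R k)) < top" by (rule le_less_trans)
    show ?thesis
    proof (rule ennreal_le_epsilon)
      fix e :: real assume e: "0 < e"
      obtain N where N: "(\<Sum>k. m (R k)) < (\<Sum>k<N. m (R k)) + e"
      proof -
        have "(\<lambda>n. (\<Sum>k<n. m (R k)) + ennreal e) \<longlonglongrightarrow> (\<Sum>k. m (R k)) + ennreal e"
          by (intro tendsto_add summable_LIMSEQ) auto
        moreover have "(\<Sum>k. m (R k)) < (\<Sum>k. m (R k)) + ennreal e" using fin e by simp
        ultimately have "eventually (\<lambda>n. (\<Sum>k. m (R k)) < (\<Sum>k<n. m (R k)) + ennreal e) sequentially"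
          by (rule order_tendstoD(1))
        then show ?thesis using that by (auto simp: eventually_sequentially)
      qed
      have tail: "(\<Sum>k. m (R (k + N))) \<le> e"
      proof -
        have "(\<Sum>k. m (R k)) = (\<Sum>k<N. m (R k)) + (\<Sum>k. m (R (k + N)))"
          using suminf_offset[of "\<lambda>k. m (R k)" N] by (simp add: add.commute)
        moreover have "(\<Sum>k<N. m (R k)) < top"
          using fin sum_le_suminf[of "\<lambda>k. m (R k)" "{..<N}"] le_less_trans by fastforce
        ultimately show ?thesis using N
          by (metis add_left_mono ennreal_add_left_cancel_less linorder_not_le order_le_less_trans
              order_less_imp_le)
      qed
      have cover: "A - F \<subseteq> D N \<union> (\<Union>k. R (k + N))"
      proof
        fix x assume x: "x \<in> A - F"
        then have "0 < infdist x F" using F by (simp add: in_closed_iff_infdist_zero order_less_le infdist_nonneg)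
        then obtain n where n: "1 / (real n + 1) \<le> infdist x F"
          by (metis less_eq_real_def nat_approx_posE of_nat_Suc add.commute)
        then have ex: "\<exists>n. x \<in> D n" using x by (auto simp: D_def)
        \<comment> \<open>If the first index \<open>n0\<close> with \<open>x\<close> in
          \<open>D n0\<close> exceeds \<open>N\<close>, then \<open>x\<close> lies in the shell
          \<open>R (n0 - 1)\<close>, because \<open>R k\<close> is what \<open>D\<close> gains from
          k to k + 1.\<close>
        define n0 where "n0 = (LEAST n. x \<in> D n)"
        have n0: "x \<in> D n0" "\<And>j. j < n0 \<Longrightarrow> x \<notin> D j"
          unfolding n0_def by (rule LeastI_ex[OF ex], rule not_less_Least)
        show "x \<in> D N \<union> (\<Union>k. R (k + N))"
        proof (cases "n0 \<le> N")
          case True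
          then have "1 / (real N + 1) \<le> 1 / (real n0 + 1)" by (simp add: field_simps)
          then show ?thesis using n0(1) by (auto simp: D_def)
        next
          case False
          then have "n0 = Suc ((n0 - 1 - N) + N)" by simp
          then have "x \<in> R ((n0 - 1 - N) + N)" using n0 unfolding R_def by (metis DiffI lessI)
          then show ?thesis by blast
        qed
      qed
      have "m (A \<inter> F) + m (D N) \<le> m (A \<inter> F \<union> D N)"
      proof (rule metric)
        fix a b assume "a \<in> A \<inter> F" "b \<in> D N"
        then show "1 / (real N + 1) \<le> dist a b"
          using infdist_le[of a F b] by (auto simp: D_def dist_commute)
      qed auto
      also have "\<dots> \<le> m A" by (rule mono) (use D_sub in auto)
      finally have 1: "m (A \<inter> F) + m (D N) \<le> m A" .
      have "m (A - F) \<le> m (D N \<union> (\<Union>k. R (k + N)))" using cover by (rule mono)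
      also have "\<dots> \<le> m (D N) + m (\<Union>k. R (k + N))" by (rule subadd2)
      also have "\<dots> \<le> m (D N) + (\<Sum>k. m (R (k + N)))" by (intro add_left_mono subadd)
      also have "\<dots> \<le> m (D N) + e" by (intro add_left_mono tail)
      finally have "m (A \<inter> F) + m (A - F) \<le> m (A \<inter> F) + (m (D N) + e)" by (rule add_left_mono)
      also have "\<dots> = (m (A \<inter> F) + m (D N)) + e" by (simp add: ac_simps)
      also have "\<dots> \<le> m A + e" using 1 by (rule add_right_mono)
      finally show "m (A \<inter> F) + m (A - F) \<le> m A + e" .
    qed
  qed simp
  interpret P: sigma_algebra UNIV "UNIV :: 'a set set"
    using sigma_algebra_Pow[of UNIV] by simp
  have ms: "measure_space UNIV (lambda_system UNIV UNIV m) m"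
    by (rule P.caratheodory_lemma)
      (auto simp: outer_measure_space_def positive_def increasing_def countably_subadditive_def
        empty intro: mono subadd)
  have "F \<in> lambda_system UNIV UNIV m" if "closed F" for F
  proof (cases "F = {}")
    case True
    then show ?thesis by (simp add: P.lambda_system_eq empty)
  next
    case False
    have "m (A \<inter> F) + m (A - F) = m A" for A
      using closed_split[OF that False, of A] subadd2[of "A \<inter> F" "A - F"]
      by (simp add: Int_Diff_Un antisym)
    then show ?thesis by (simp add: P.lambda_system_eq)
  qed
  moreover have "sigma_algebra UNIV (lambda_system UNIV UNIV m)"
    using ms by (simp add: measure_space_def)
  ultimately have "sigma_sets UNIV (Collect closed) \<subseteq> lambda_system UNIV UNIV m"
    by (intro sigma_algebra.sigma_sets_subset) auto
  then have "sets borel \<subseteq> lambda_system UNIV UNIV m"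
    by (simp add: borel_eq_closed)
  then show ?thesis
    using ms by (intro measure_down[OF ms]) (metis sets.sigma_algebra_axioms space_borel)
qed

section \<open>Hausdorff outer measure as a metric outer measure\<close>

text \<open>The premeasure inside \<open>hausdorff_outer\<close> at a fixed mesh \<delta>.
  Subadditivity is inherited from each fixed \<delta>, whereas additivity on separated sets appears
  once \<delta> is below the separation.\<close>

definition hausdorff_content :: "nat \<Rightarrow> real \<Rightarrow> 'a::metric_space set \<Rightarrow> ennreal" where
  "hausdorff_content n \<delta> A =
     (INF C\<in>{C :: nat \<Rightarrow> 'a set. A \<subseteq> (\<Union>i. C i) \<and> (\<forall>i. bounded (C i) \<and> diameter (C i) \<le> \<delta>)}.
        (\<Sum>i. hausdorff_weight n (C i)))"

lemma hausdorff_outer_eq_SUP: "hausdorff_outer n A = (SUP \<delta>\<in>{0<..}. hausdorff_content n \<delta> A)"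
  by (simp add: hausdorff_outer_def hausdorff_content_def)

lemma hausdorff_content_le_outer: "0 < \<delta> \<Longrightarrow> hausdorff_content n \<delta> A \<le> hausdorff_outer n A"
  unfolding hausdorff_outer_eq_SUP by (rule SUP_upper) simp

lemma hausdorff_content_le:
  assumes "A \<subseteq> (\<Union>i. C i)" "\<And>i. bounded (C i)" "\<And>i. diameter (C i) \<le> \<delta>"
  shows "hausdorff_content n \<delta> A \<le> (\<Sum>i. hausdorff_weight n (C i))"
  unfolding hausdorff_content_def using assms by (intro INF_lower) auto

lemma le_hausdorff_contentI:
  assumes "\<And>C :: nat \<Rightarrow> 'a::metric_space set. A \<subseteq> (\<Union>i. C i) \<Longrightarrow> (\<And>i. bounded (C i)) \<Longrightarrow>
    (\<And>i. diameter (C i) \<le> \<delta>) \<Longrightarrow> x \<le> (\<Sum>i. hausdorff_weight n (C i))"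
  shows "x \<le> hausdorff_content n \<delta> A"
  unfolding hausdorff_content_def using assms by (intro INF_greatest) auto

lemma hausdorff_content_antimono:
  "\<delta> \<le> \<delta>' \<Longrightarrow> hausdorff_content n \<delta>' A \<le> hausdorff_content n \<delta> A"
proof (rule le_hausdorff_contentI)
  fix C :: "nat \<Rightarrow> 'a set"
  assume \<delta>: "\<delta> \<le> \<delta>'" and C: "A \<subseteq> (\<Union>i. C i)" "\<And>i. bounded (C i)" "\<And>i. diameter (C i) \<le> \<delta>"
  show "hausdorff_content n \<delta>' A \<le> (\<Sum>i. hausdorff_weight n (C i))"
    using C(1,2) order_trans[OF C(3) \<delta>] by (rule hausdorff_content_le)
qed

lemma hausdorff_content_mono:
  "A \<subseteq> B \<Longrightarrow> hausdorff_content n \<delta> A \<le> hausdorff_content n \<delta> B"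
  by (rule le_hausdorff_contentI, rule hausdorff_content_le) auto

lemma hausdorff_outer_mono: "A \<subseteq> B \<Longrightarrow> hausdorff_outer n A \<le> hausdorff_outer n B"
  unfolding hausdorff_outer_eq_SUP by (intro SUP_subset_mono hausdorff_content_mono order_refl)

lemma hausdorff_weight_empty [simp]: "hausdorff_weight n {} = 0"
  by (simp add: hausdorff_weight_def)

text \<open>Each \<open>A i\<close> gets a cover that wastes at most e / 2^(i+1); the pairing
  function merges all these covers into one sequence.\<close>

lemma hausdorff_content_UN:
  "hausdorff_content n \<delta> (\<Union>i::nat. A i) \<le> (\<Sum>i. hausdorff_content n \<delta> (A i))"
proof (rule ennreal_le_epsilon)
  fix e :: real assume "0 < e" "(\<Sum>i. hausdorff_content n \<delta> (A i)) < top"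
  then have "hausdorff_content n \<delta> (A i) < hausdorff_content n \<delta> (A i) + e * (1/2)^Suc i" for i
    by (auto simp add: less_top dest!: ennreal_suminf_lessD)
  then have "\<exists>C. A i \<subseteq> (\<Union>j. C j) \<and> (\<forall>j. bounded (C j) \<and> diameter (C j) \<le> \<delta>) \<and>
      (\<Sum>j. hausdorff_weight n (C j)) < hausdorff_content n \<delta> (A i) + e * (1/2)^Suc i" for i
    unfolding hausdorff_content_def INF_less_iff by blast
  then obtain C where C: "\<And>i. A i \<subseteq> (\<Union>j. C i j)" "\<And>i j. bounded (C i j)"
      "\<And>i j. diameter (C i j) \<le> \<delta>"
      "\<And>i. (\<Sum>j. hausdorff_weight n (C i j)) < hausdorff_content n \<delta> (A i) + e * (1/2)^Suc i"
    by metis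
  define B where "B = case_prod C \<circ> prod_decode"
  have "(\<Union>i. A i) \<subseteq> (\<Union>k. B k)"
    using C(1) by (auto simp: B_def subset_eq) (metis prod.case prod_encode_inverse)
  then have "hausdorff_content n \<delta> (\<Union>i. A i) \<le> (\<Sum>k. hausdorff_weight n (B k))"
    by (rule hausdorff_content_le) (auto simp: B_def C split: prod.split)
  also have "\<dots> = (\<Sum>i. \<Sum>j. hausdorff_weight n (C i j))"
    unfolding B_def comp_def by (subst suminf_ennreal_2dimen[symmetric]) (auto split: prod.split)
  also have "\<dots> \<le> (\<Sum>i. hausdorff_content n \<delta> (A i) + e * (1/2) ^ Suc i)"
    using C(4) by (intro suminf_le allI less_imp_le) auto
  also have "\<dots> = (\<Sum>i. hausdorff_content n \<delta> (A i)) + (\<Sum>i. ennreal e * ennreal ((1/2) ^ Suc i))"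
    using \<open>0 < e\<close>
    by (subst suminf_add[symmetric]) (auto simp del: ennreal_suminf_cmult simp: ennreal_mult[symmetric])
  also have "\<dots> = (\<Sum>i. hausdorff_content n \<delta> (A i)) + e"
    unfolding ennreal_suminf_cmult
    by (subst suminf_ennreal_eq[OF zero_le_power power_half_series]) auto
  finally show "hausdorff_content n \<delta> (\<Union>i. A i) \<le> (\<Sum>i. hausdorff_content n \<delta> (A i)) + e" .
qed

lemma hausdorff_outer_UN:
  "hausdorff_outer n (\<Union>i::nat. A i) \<le> (\<Sum>i. hausdorff_outer n (A i))"
  unfolding hausdorff_outer_eq_SUP[of n "\<Union>i. A i"]
  by (intro SUP_least order_trans[OF hausdorff_content_UN] suminf_le)
    (auto intro: hausdorff_content_le_outer)

lemma hausdorff_outer_empty [simp]: "hausdorff_outer n {} = 0"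
proof -
  have "hausdorff_content n \<delta> {} = 0" if "0 < \<delta>" for \<delta>
    using hausdorff_content_le[of "{}" "\<lambda>i. {}" \<delta> n] that by simp
  then show ?thesis unfolding hausdorff_outer_eq_SUP by (intro antisym SUP_least) simp_all
qed

text \<open>A set of diameter below \<open>d\<close> cannot meet both \<open>A\<close> and
  \<open>B\<close>, so a cover of the union falls into a cover of \<open>A\<close> and a disjoint
  subfamily covering \<open>B\<close>.\<close>

lemma hausdorff_content_Un_separated:
  assumes "\<delta> < d" "\<And>a b. a \<in> A \<Longrightarrow> b \<in> B \<Longrightarrow> d \<le> dist a b"
  shows "hausdorff_content n \<delta> A + hausdorff_content n \<delta> B \<le> hausdorff_content n \<delta> (A \<union> B)"
proof (rule le_hausdorff_contentI)
  fix C :: "nat \<Rightarrow> 'a set"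
  assume C: "A \<union> B \<subseteq> (\<Union>i. C i)" "\<And>i. bounded (C i)" "\<And>i. diameter (C i) \<le> \<delta>"
  \<comment> \<open>Discarded members become empty and so weigh 0, which keeps the indexing. Their
    diameter 0 must still be at most \<delta>, hence the next fact.\<close>
  define meet where "meet S i = (if C i \<inter> S \<noteq> {} then C i else {})" for S i
  have \<delta>: "0 \<le> \<delta>" using C(3)[of 0] diameter_ge_0[OF C(2)[of 0]] by linarith
  have cover: "hausdorff_content n \<delta> S \<le> (\<Sum>i. hausdorff_weight n (meet S i))"
    if "S \<subseteq> A \<union> B" for S
  proof (rule hausdorff_content_le)
    show "S \<subseteq> (\<Union>i. meet S i)" using that C(1) by (fastforce simp: meet_def)
  qed (use C \<delta> in \<open>auto simp: meet_def\<close>)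
  have "hausdorff_content n \<delta> A + hausdorff_content n \<delta> B \<le>
      (\<Sum>i. hausdorff_weight n (meet A i)) + (\<Sum>i. hausdorff_weight n (meet B i))"
    by (intro add_mono cover) auto
  also have "\<dots> = (\<Sum>i. hausdorff_weight n (meet A i) + hausdorff_weight n (meet B i))"
    by (rule suminf_add) auto
  also have "\<dots> \<le> (\<Sum>i. hausdorff_weight n (C i))"
  proof (intro suminf_le)
    fix i
    have "C i \<inter> A = {} \<or> C i \<inter> B = {}"
    proof (rule ccontr)
      assume "\<not> ?thesis"
      then obtain a b where "a \<in> C i" "a \<in> A" "b \<in> C i" "b \<in> B" by auto
      then show False
        using assms diameter_bounded_bound[OF C(2), of a i b] C(3)[of i] by fastforce
    qed
    then show "hausdorff_weight n (meet A i) + hausdorff_weight n (meet B i) \<le> hausdorff_weight n (C i)"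
      by (auto simp: meet_def)
  qed auto
  finally show "hausdorff_content n \<delta> A + hausdorff_content n \<delta> B \<le> (\<Sum>i. hausdorff_weight n (C i))" .
qed

lemma hausdorff_outer_Un_separated:
  assumes d: "0 < d" "\<And>a b. a \<in> A \<Longrightarrow> b \<in> B \<Longrightarrow> d \<le> dist a b"
  shows "hausdorff_outer n A + hausdorff_outer n B \<le> hausdorff_outer n (A \<union> B)"
proof -
  have "hausdorff_content n \<delta> A + hausdorff_content n \<delta>' B \<le> hausdorff_outer n (A \<union> B)"
    if "0 < \<delta>" "0 < \<delta>'" for \<delta> \<delta>'
  proof -
    \<comment> \<open>The two suprema run over independent meshes. A common finer mesh, below the
      separation, only increases both contents.\<close>
    define \<eta> where "\<eta> = min (min \<delta> \<delta>') (d / 2)"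
    have \<eta>: "0 < \<eta>" "\<eta> \<le> \<delta>" "\<eta> \<le> \<delta>'" "\<eta> < d" using that d by (auto simp: \<eta>_def)
    have "hausdorff_content n \<delta> A + hausdorff_content n \<delta>' B \<le>
        hausdorff_content n \<eta> A + hausdorff_content n \<eta> B"
      using \<eta> by (intro add_mono hausdorff_content_antimono)
    also have "\<dots> \<le> hausdorff_content n \<eta> (A \<union> B)"
      using \<eta> d by (intro hausdorff_content_Un_separated)
    also have "\<dots> \<le> hausdorff_outer n (A \<union> B)" using \<eta> by (intro hausdorff_content_le_outer)
    finally show ?thesis .
  qed
  note le = this
  have "hausdorff_content n \<delta> A + hausdorff_outer n B \<le> hausdorff_outer n (A \<union> B)" if "0 < \<delta>" for \<delta>
  proof -
    have "hausdorff_content n \<delta> A + hausdorff_outer n B =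
        (SUP \<delta>'\<in>{0<..}. hausdorff_content n \<delta> A + hausdorff_content n \<delta>' B)"
      unfolding hausdorff_outer_eq_SUP[of n B] by (rule ennreal_SUP_add_right) auto
    also have "\<dots> \<le> hausdorff_outer n (A \<union> B)" using le that by (intro SUP_least) auto
    finally show ?thesis .
  qed
  moreover have "hausdorff_outer n A + hausdorff_outer n B =
      (SUP \<delta>\<in>{0<..}. hausdorff_content n \<delta> A + hausdorff_outer n B)"
    unfolding hausdorff_outer_eq_SUP[of n A] by (rule ennreal_SUP_add_left[symmetric]) auto
  ultimately show ?thesis by (simp add: SUP_le_iff)
qed

lemma space_hausdorff_measure [simp]: "space (hausdorff_measure n) = UNIV"
  by (simp add: hausdorff_measure_def)

lemma sets_hausdorff_measure [simp, measurable_cong]: "sets (hausdorff_measure n) = sets borel"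
  using sets.sigma_sets_eq[of borel] by (simp add: hausdorff_measure_def)

text \<open>\<open>measure_of\<close> falls back to the zero measure unless its function is
  countably additive on the generated \<sigma>-algebra; the criterion for metric outer measures
  excludes this.\<close>

lemma emeasure_hausdorff_measure:
  assumes "A \<in> sets borel"
  shows "emeasure (hausdorff_measure n) A = hausdorff_outer n A"
proof (rule emeasure_measure_of[OF hausdorff_measure_def])
  have "measure_space UNIV (sets borel) (hausdorff_outer n :: 'a set \<Rightarrow> ennreal)"
    by (rule metric_outer_measure_borel)
      (rule hausdorff_outer_empty hausdorff_outer_mono hausdorff_outer_UN
        hausdorff_outer_Un_separated; assumption)+
  then show "positive (sets (hausdorff_measure n)) (hausdorff_outer n :: 'a set \<Rightarrow> ennreal)"
    and "countably_additive (sets (hausdorff_measure n)) (hausdorff_outer n :: 'a set \<Rightarrow> ennreal)"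
    by (simp_all add: measure_space_def)
qed (use assms in auto)

section \<open>One-dimensional Hausdorff measure on smooth arcs\<close>

text \<open>The normalising factor is \<open>unit_ball_vol 1 / 2 = 1\<close>, and the empty set
  conforms because its diameter is 0.\<close>

lemma hausdorff_weight_1: "bounded C \<Longrightarrow> hausdorff_weight 1 C = ennreal (diameter C)"
  by (simp add: hausdorff_weight_def)

text \<open>The map \<^term>\<open>dist x\<close> is 1-Lipschitz and its image of \<open>S\<close> contains the interval
  \<open>[0, dist x y]\<close>.\<close>

lemma dist_le_hausdorff_outer_1:
  assumes S: "connected S" "x \<in> S" "y \<in> S"
  shows "ennreal (dist x y) \<le> hausdorff_outer 1 S"
proof -
  have "ennreal (dist x y) \<le> hausdorff_content 1 1 S"
  proof (rule le_hausdorff_contentI)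
    fix C :: "nat \<Rightarrow> 'a set"
    assume C: "S \<subseteq> (\<Union>i. C i)" "\<And>i. bounded (C i)"
    \<comment> \<open>An interval of length \<open>diameter (C i)\<close> holds the image of
      \<open>C i\<close>, so its Lebesgue measure is the weight of \<open>C i\<close>. An empty
      \<open>C i\<close> yields a single point, of length 0.\<close>
    define I where "I i = {Inf (dist x ` C i) .. Inf (dist x ` C i) + diameter (C i)}" for i
    have sub: "dist x ` C i \<subseteq> I i" for i
    proof
      fix r assume "r \<in> dist x ` C i"
      then obtain z where z: "z \<in> C i" "r = dist x z" by auto
      have bdd: "bdd_below (dist x ` C i)" by (rule bdd_belowI2[of _ 0]) simp
      have "Inf (dist x ` C i) \<le> r" using z by (auto intro: cInf_lower bdd)
      moreover have "r - diameter (C i) \<le> Inf (dist x ` C i)"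
      proof (rule cInf_greatest)
        fix q assume "q \<in> dist x ` C i"
        then obtain w where w: "w \<in> C i" "q = dist x w" by auto
        show "r - diameter (C i) \<le> q"
          using diameter_bounded_bound[OF C(2) z(1) w(1)] dist_triangle[of x z w] z w
          by (simp add: dist_commute)
      qed (use z in auto)
      ultimately show "r \<in> I i" by (simp add: I_def)
    qed
    have "connected (dist x ` S)"
      by (intro connected_continuous_image S continuous_intros)
    moreover have "0 \<in> dist x ` S" "dist x y \<in> dist x ` S" using S by force+
    ultimately have "{0..dist x y} \<subseteq> dist x ` S" by (rule connected_contains_Icc)
    also have "\<dots> \<subseteq> dist x ` (\<Union>i. C i)" by (rule image_mono[OF C(1)])
    also have "\<dots> \<subseteq> (\<Union>i. I i)" unfolding image_UN by (rule UN_mono[OF subset_refl sub])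
    finally have "emeasure lborel {0..dist x y} \<le> emeasure lborel (\<Union>i. I i)"
      by (intro emeasure_mono) (auto simp: I_def)
    also have "\<dots> \<le> (\<Sum>i. emeasure lborel (I i))"
      by (intro emeasure_subadditive_countably) (auto simp: I_def)
    also have "\<dots> = (\<Sum>i. hausdorff_weight 1 (C i))"
      using C(2) by (simp add: I_def hausdorff_weight_1[OF C(2), unfolded One_nat_def] diameter_ge_0)
    finally show "ennreal (dist x y) \<le> (\<Sum>i. hausdorff_weight 1 (C i))" by simp
  qed
  also have "\<dots> \<le> hausdorff_outer 1 S" by (rule hausdorff_content_le_outer) simp
  finally show ?thesis .
qed

text \<open>Cutting the interval into \<open>N\<close> equal pieces makes the diameters of the
  images as small as desired, while their sum stays below \<open>K * (d - c)\<close> for every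
  \<open>N\<close>.\<close>

lemma hausdorff_outer_1_lipschitz_image:
  fixes g :: "real \<Rightarrow> 'a::metric_space"
  assumes lip: "\<And>s t. s \<in> {c..d} \<Longrightarrow> t \<in> {c..d} \<Longrightarrow> dist (g s) (g t) \<le> K * \<bar>s - t\<bar>"
    and "c \<le> d" "0 \<le> K"
  shows "hausdorff_outer 1 (g ` {c..d}) \<le> ennreal (K * (d - c))"
  unfolding hausdorff_outer_eq_SUP
proof (intro SUP_least)
  fix \<delta> :: real assume "\<delta> \<in> {0<..}"
  then have \<delta>: "0 < \<delta>" by simp
  obtain N :: nat where N: "K * (d - c) / \<delta> < real N"
    using reals_Archimedean2 by blast
  moreover have "0 \<le> K * (d - c) / \<delta>" using assms \<delta> by simp
  ultimately have N: "K * (d - c) / \<delta> < real N" "0 < N" by linarith+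
  define h where "h = (d - c) / N"
  have h: "0 \<le> h" "c + N * h = d" using assms N by (auto simp: h_def)
  have Kh: "K * h \<le> \<delta>" using N \<delta> by (simp add: h_def field_simps)
  define C where "C i = (if i < N then g ` {c + i * h..c + (i + 1) * h} else {})" for i :: nat
  have piece: "{c + i * h..c + (i + 1) * h} \<subseteq> {c..d}" if "i < N" for i :: nat
  proof -
    have "(real i + 1) * h \<le> N * h" using that h by (intro mult_right_mono) auto
    moreover have "0 \<le> i * h" using h by simp
    ultimately show ?thesis using h by (auto simp: add.commute)
  qed
  have dist_C: "dist a b \<le> K * h" if "a \<in> C i" "b \<in> C i" for a b i
  proof -
    from that have i: "i < N" by (auto simp: C_def split: if_splits)
    with that obtain s t where st: "a = g s" "b = g t" "s \<in> {c + i * h..c + (i + 1) * h}"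
      "t \<in> {c + i * h..c + (i + 1) * h}" by (auto simp: C_def)
    have "dist a b \<le> K * \<bar>s - t\<bar>" unfolding st(1,2) using piece[OF i] st(3,4) by (intro lip) auto
    also have "\<dots> \<le> K * h" using st(3,4) assms by (intro mult_left_mono) (auto simp: algebra_simps)
    finally show ?thesis .
  qed
  have bdd: "bounded (C i)" for i unfolding bounded_two_points using dist_C by blast
  have diam: "diameter (C i) \<le> K * h" for i
    using dist_C[of _ i] assms h by (auto simp: diameter_def intro!: cSUP_least)
  have split: "{c..c + n * h} \<subseteq> (\<Union>i<n. {c + i * h..c + (i + 1) * h})" if "0 < n" for n :: nat
    using that
  proof (induction n rule: nat_induct_non_zero)
    case (Suc n)
    have "{c..c + Suc n * h} \<subseteq> {c..c + n * h} \<union> {c + n * h..c + (n + 1) * h}"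
      by (auto simp: add.commute)
    then show ?case using Suc.IH by (auto simp: lessThan_Suc)
  qed (simp add: lessThan_Suc)
  have "hausdorff_content 1 \<delta> (g ` {c..d}) \<le> (\<Sum>i. hausdorff_weight 1 (C i))"
  proof (rule hausdorff_content_le)
    show "g ` {c..d} \<subseteq> (\<Union>i. C i)"
      using split[OF N(2)] unfolding h(2) C_def by fastforce
    show "diameter (C i) \<le> \<delta>" for i using diam[of i] Kh by simp
  qed (rule bdd)
  also have "\<dots> = (\<Sum>i<N. hausdorff_weight 1 (C i))"
    by (rule suminf_finite) (auto simp: C_def)
  also have "\<dots> \<le> (\<Sum>i<N. ennreal (K * h))"
    using diam by (intro sum_mono) (auto simp: hausdorff_weight_1[OF bdd, unfolded One_nat_def] intro: ennreal_leI)
  also have "\<dots> = ennreal (K * (d - c))"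
    using N assms by (simp add: h_def ennreal_of_nat_eq_real_of_nat ennreal_mult[symmetric])
  finally show "hausdorff_content 1 \<delta> (g ` {c..d}) \<le> ennreal (K * (d - c))" .
qed

section \<open>Length measure of an injective C^1 arc and change of variables\<close>

locale smooth_arc =
  fixes \<gamma> \<gamma>' :: "real \<Rightarrow> 'a::euclidean_space" and c d :: real
  assumes le: "c \<le> d"
    and inj: "inj_on \<gamma> {c..d}"
    and deriv: "\<And>t. t \<in> {c..d} \<Longrightarrow> (\<gamma> has_vector_derivative \<gamma>' t) (at t within {c..d})"
    and cont_deriv: "continuous_on {c..d} \<gamma>'"
begin

lemma cont: "continuous_on {c..d} \<gamma>"
  unfolding continuous_on_eq_continuous_within
  using deriv by (blast intro: has_vector_derivative_continuous)

lemma dist_le: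
  assumes "c \<le> x" "y \<le> d" "\<And>t. t \<in> {x..y} \<Longrightarrow> norm (\<gamma>' t) \<le> K" "s \<in> {x..y}" "t \<in> {x..y}"
  shows "dist (\<gamma> s) (\<gamma> t) \<le> K * \<bar>s - t\<bar>"
proof -
  have "norm (\<gamma> s - \<gamma> t) \<le> K * norm (s - t)"
  proof (rule differentiable_bound[where S="{x..y}" and f'="\<lambda>t h. h *\<^sub>R \<gamma>' t"])
    fix u assume "u \<in> {x..y}"
    then show "(\<gamma> has_derivative (\<lambda>h. h *\<^sub>R \<gamma>' u)) (at u within {x..y})"
      using deriv[of u] assms(1,2) has_derivative_subset[of \<gamma> _ u "{c..d}" "{x..y}"]
      by (auto simp: has_vector_derivative_def)
    show "onorm (\<lambda>h. h *\<^sub>R \<gamma>' u) \<le> K"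
      using onorm_scaleR_left[of "\<lambda>h::real. h" "\<gamma>' u"] assms(3)[OF \<open>u \<in> {x..y}\<close>]
      by (simp add: onorm_id)
  qed (use assms in auto)
  then show ?thesis by (simp add: dist_norm)
qed

lemma image_borel: "c \<le> x \<Longrightarrow> y \<le> d \<Longrightarrow> \<gamma> ` {x..y} \<in> sets borel"
  by (intro borel_compact compact_continuous_image continuous_on_subset[OF cont]) auto

lemma length_le:
  assumes "c \<le> x" "x \<le> y" "y \<le> d" "\<And>t. t \<in> {x..y} \<Longrightarrow> norm (\<gamma>' t) \<le> K"
  shows "emeasure (hausdorff_measure 1) (\<gamma> ` {x..y}) \<le> ennreal (K * (y - x))"
proof -
  have "0 \<le> K" using assms(4)[of x] assms(2) norm_ge_zero[of "\<gamma>' x"] by (simp del: norm_ge_zero)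
  moreover have "dist (\<gamma> s) (\<gamma> t) \<le> K * \<bar>s - t\<bar>" if "s \<in> {x..y}" "t \<in> {x..y}" for s t
    using assms that by (intro dist_le[of x y K]) simp_all
  ultimately show ?thesis
    unfolding emeasure_hausdorff_measure[OF image_borel[OF assms(1,3)]]
    using assms(2) by (intro hausdorff_outer_1_lipschitz_image)
qed

lemma dist_le_length:
  assumes "c \<le> x" "x \<le> y" "y \<le> d"
  shows "ennreal (dist (\<gamma> x) (\<gamma> y)) \<le> emeasure (hausdorff_measure 1) (\<gamma> ` {x..y})"
  unfolding emeasure_hausdorff_measure[OF image_borel[OF assms(1,3)]]
  using assms by (intro dist_le_hausdorff_outer_1 connected_continuous_image
      continuous_on_subset[OF cont]) auto

text \<open>Real-valued, since it is to be differentiated. For \<open>x \<le> d\<close> the length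
  is finite by \<open>length_finite\<close>, so the value 0 that \<open>measure\<close> gives to
  sets of infinite measure does not interfere.\<close>

definition arclength :: "real \<Rightarrow> real" where
  "arclength x = measure (hausdorff_measure 1) (\<gamma> ` {c..x})"

lemma length_finite:
  assumes "c \<le> x" "y \<le> d"
  shows "emeasure (hausdorff_measure 1) (\<gamma> ` {x..y}) < top"
proof (cases "x \<le> y")
  case True
  obtain K where K: "\<And>t. t \<in> {c..d} \<Longrightarrow> norm (\<gamma>' t) \<le> K"
    using compact_imp_bounded[OF compact_continuous_image[OF cont_deriv compact_Icc]]
    unfolding bounded_iff by (metis imageI)
  have "emeasure (hausdorff_measure 1) (\<gamma> ` {x..y}) \<le> ennreal (K * (y - x))"
    using assms True K by (intro length_le) auto
  then show ?thesis by (rule le_less_trans) simp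
qed simp

lemma emeasure_point:
  assumes "x \<in> {c..d}"
  shows "emeasure (hausdorff_measure 1) {\<gamma> x} = 0"
  using length_le[of x x "norm (\<gamma>' x)"] assms by simp

text \<open>Injectivity makes the two images differ by exactly one point, which has length
  0.\<close>

lemma emeasure_half_open:
  assumes "c \<le> x" "x \<le> d" "y \<le> d"
  shows "emeasure (hausdorff_measure 1) (\<gamma> ` {x<..y}) = emeasure (hausdorff_measure 1) (\<gamma> ` {x..y})"
proof (cases "x \<le> y")
  case True
  have "{x<..y} = {x..y} - {x}" by auto
  then have eq: "\<gamma> ` {x<..y} = \<gamma> ` {x..y} - {\<gamma> x}"
    using assms True inj_on_image_set_diff[OF inj, of "{x..y}" "{x}"] by fastforce
  show ?thesis unfolding eq
    using assms emeasure_point image_borel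
    by (intro emeasure_Diff_null_set) (auto simp: null_sets_def)
qed auto

lemma arclength_diff:
  assumes "c \<le> x" "x \<le> y" "y \<le> d"
  shows "emeasure (hausdorff_measure 1) (\<gamma> ` {x..y}) = ennreal (arclength y - arclength x)"
    and "arclength x \<le> arclength y"
proof -
  let ?M = "hausdorff_measure 1 :: 'a measure"
  have ivl: "{x<..y} = {c..y} - {c..x}" using assms by auto
  have eq: "\<gamma> ` {x<..y} = \<gamma> ` {c..y} - \<gamma> ` {c..x}"
    using assms inj_on_image_set_diff[OF inj, of "{c..y}" "{c..x}"]
    by (fastforce simp: ivl)
  have "emeasure ?M (\<gamma> ` {x<..y}) = emeasure ?M (\<gamma> ` {c..y}) - emeasure ?M (\<gamma> ` {c..x})"
    unfolding eq using assms length_finite[of c x]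
    by (intro emeasure_Diff) (auto intro: image_borel)
  moreover have L: "emeasure ?M (\<gamma> ` {c..z}) = ennreal (arclength z)" if "z \<le> d" for z
    unfolding arclength_def using length_finite[of c z] that
    by (intro emeasure_eq_ennreal_measure) auto
  ultimately show "emeasure ?M (\<gamma> ` {x..y}) = ennreal (arclength y - arclength x)"
    using emeasure_half_open[of x y] assms by (simp add: ennreal_minus arclength_def)
  have "emeasure ?M (\<gamma> ` {c..x}) \<le> emeasure ?M (\<gamma> ` {c..y})"
    using assms by (intro emeasure_mono) (auto intro: image_borel)
  then show "arclength x \<le> arclength y"
    unfolding arclength_def measure_def using length_finite[of c y] assms by (intro enn2real_mono) auto
qed

text \<open>The length of a short arc lies between its chord and the maximal speed times the
  parameter length. Differentiability of \<gamma> controls the chord, continuity of the derivative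
  controls the speed, and both bounds are \<open>norm (\<gamma>' x)\<close> times the parameter
  length to first order.\<close>

lemma arclength_deriv:
  assumes x: "x \<in> {c..d}"
  shows "(arclength has_vector_derivative norm (\<gamma>' x)) (at x within {c..d})"
  unfolding has_vector_derivative_def has_derivative_within_alt
proof (intro conjI allI impI)
  fix e :: real assume e: "0 < e"
  from deriv[OF x] e obtain r where r: "0 < r"
    "\<And>y. y \<in> {c..d} \<Longrightarrow> norm (y - x) < r \<Longrightarrow> norm (\<gamma> y - \<gamma> x - (y - x) *\<^sub>R \<gamma>' x) \<le> e * norm (y - x)"
    unfolding has_vector_derivative_def has_derivative_within_alt by blast
  from cont_deriv x e obtain q where q: "0 < q"
    "\<And>y. y \<in> {c..d} \<Longrightarrow> dist y x < q \<Longrightarrow> dist (\<gamma>' y) (\<gamma>' x) < e"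
    unfolding continuous_on_iff by blast
  have "norm (arclength y - arclength x - (y - x) *\<^sub>R norm (\<gamma>' x)) \<le> e * norm (y - x)"
    if y: "y \<in> {c..d}" "norm (y - x) < min r q" for y
  proof -
    \<comment> \<open>Ordering the endpoints treats increments of either sign together.\<close>
    define a b where "a = min x y" and "b = max x y"
    have ab: "c \<le> a" "a \<le> b" "b \<le> d" "b - a = \<bar>y - x\<bar>" using x y by (auto simp: a_def b_def)
    have E: "emeasure (hausdorff_measure 1) (\<gamma> ` {a..b}) = ennreal (arclength b - arclength a)"
      "arclength a \<le> arclength b"
      using arclength_diff[OF ab(1-3)] by auto
    have "arclength b - arclength a \<le> (norm (\<gamma>' x) + e) * (b - a)"
    proof -
      have "norm (\<gamma>' t) \<le> norm (\<gamma>' x) + e" if "t \<in> {a..b}" for t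
      proof -
        have "dist t x < q" using that y by (auto simp: a_def b_def dist_real_def)
        then have "dist (\<gamma>' t) (\<gamma>' x) < e" using that ab by (intro q) auto
        then show ?thesis using norm_triangle_ineq2[of "\<gamma>' t" "\<gamma>' x"] by (simp add: dist_norm)
      qed
      from length_le[OF ab(1-3) this] show ?thesis
        using E ab(2) e by (simp add: ennreal_le_iff)
    qed
    moreover have "(norm (\<gamma>' x) - e) * (b - a) \<le> arclength b - arclength a"
    proof -
      have "norm ((y - x) *\<^sub>R \<gamma>' x) - norm (\<gamma> y - \<gamma> x) \<le> norm (\<gamma> y - \<gamma> x - (y - x) *\<^sub>R \<gamma>' x)"
        using norm_triangle_ineq2[of "(y - x) *\<^sub>R \<gamma>' x" "\<gamma> y - \<gamma> x"] by (simp add: norm_minus_commute)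
      also have "\<dots> \<le> e * norm (y - x)" using y by (intro r) auto
      finally have "(norm (\<gamma>' x) - e) * (b - a) \<le> dist (\<gamma> x) (\<gamma> y)"
        using ab unfolding norm_scaleR by (simp add: dist_norm left_diff_distrib right_diff_distrib norm_minus_commute mult.commute)
      also have "\<dots> = dist (\<gamma> a) (\<gamma> b)" by (auto simp: a_def b_def min_def max_def dist_commute)
      also have "\<dots> \<le> arclength b - arclength a"
        using dist_le_length[OF ab(1-3)] E by (simp add: ennreal_le_iff)
      finally show ?thesis .
    qed
    ultimately have "\<bar>(arclength b - arclength a) - (b - a) * norm (\<gamma>' x)\<bar> \<le> e * (b - a)"
      by (simp add: abs_le_iff algebra_simps)
    then show ?thesis
      by (cases "x \<le> y") (auto simp: a_def b_def abs_le_iff algebra_simps)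
  qed
  then show "\<exists>r>0. \<forall>y\<in>{c..d}. norm (y - x) < r \<longrightarrow>
      norm (arclength y - arclength x - (y - x) *\<^sub>R norm (\<gamma>' x)) \<le> e * norm (y - x)"
    using r(1) q(1) by (intro exI[of _ "min r q"]) auto
qed (rule bounded_linear_scaleR_left)

lemma length_eq_nn_integral:
  assumes "c \<le> x" "y \<le> d"
  shows "emeasure (hausdorff_measure 1) (\<gamma> ` {x..y}) = (\<integral>\<^sup>+t\<in>{x..y}. ennreal (norm (\<gamma>' t)) \<partial>lborel)"
proof (cases "x \<le> y")
  case True
  have "((\<lambda>t. norm (\<gamma>' t)) has_integral (arclength y - arclength x)) {x..y}"
    using arclength_deriv assms True
    by (intro fundamental_theorem_of_calculus has_vector_derivative_within_subset[OF arclength_deriv]) auto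
  then show ?thesis
    using arclength_diff[of x y] assms True by (simp add: nn_integral_has_integral_lebesgue')
qed simp

text \<open>The inverse of \<gamma> carries the length measure to the parameter line. There it
  agrees with the density \<open>norm (\<gamma>' t)\<close> on all open rays, which determines a
  measure that is finite on them.\<close>

theorem nn_integral_arc:
  fixes h :: "'a \<Rightarrow> ennreal"
  assumes [measurable]: "h \<in> borel_measurable borel"
  shows "(\<integral>\<^sup>+p\<in>\<gamma> ` {c..d}. h p \<partial>hausdorff_measure 1) =
    (\<integral>\<^sup>+t\<in>{c..d}. h (\<gamma> t) * ennreal (norm (\<gamma>' t)) \<partial>lborel)"
proof -
  let ?M = "hausdorff_measure 1 :: 'a measure" and ?G = "\<gamma> ` {c..d}"
  define p where "p = the_inv_into {c..d} \<gamma>"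
  define \<sigma> where "\<sigma> t = ennreal (indicator {c..d} t *\<^sub>R norm (\<gamma>' t))" for t
  define \<nu> where "\<nu> = distr (restrict_space ?M ?G) borel p"
  have p: "p (\<gamma> t) = t" if "t \<in> {c..d}" for t
    unfolding p_def using inj that by (rule the_inv_into_f_f)
  have G: "?G \<in> sets borel" by (rule image_borel) auto
  have "continuous_on ?G p" using continuous_on_inv[OF cont compact_Icc] p by auto
  then have "p \<in> borel_measurable (restrict_space borel ?G)"
    by (rule borel_measurable_continuous_on_restrict)
  then have p_meas [measurable]: "p \<in> borel_measurable (restrict_space ?M ?G)"
    by (simp cong: measurable_cong_sets sets_restrict_space_cong)
  have \<sigma>_meas [measurable]: "\<sigma> \<in> borel_measurable borel"
    unfolding \<sigma>_def
    by (intro measurable_ennreal[THEN measurable_compose_rev] borel_measurable_continuous_on_indicator continuous_intros cont_deriv) auto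
  have \<sigma>_eq: "\<sigma> t = ennreal (norm (\<gamma>' t)) * indicator {c..d} t" for t
    by (simp add: \<sigma>_def indicator_def)
  have eq: "\<nu> = density lborel \<sigma>"
  proof (rule measure_eqI_lessThan)
    fix x :: real
    \<comment> \<open>Up to an endpoint of length 0, the part of the arc with parameter above
      \<open>x\<close> is the image of \<open>{m..d}\<close>.\<close>
    define m where "m = max c x"
    have m: "c \<le> m" by (simp add: m_def)
    have "emeasure \<nu> {x<..} = emeasure (restrict_space ?M ?G) (p -` {x<..} \<inter> ?G)"
      unfolding \<nu>_def by (subst emeasure_distr) (auto simp: space_restrict_space)
    also have "p -` {x<..} \<inter> ?G = \<gamma> ` ({x<..} \<inter> {c..d})" using p by auto
    also have "emeasure (restrict_space ?M ?G) \<dots> = emeasure ?M (\<gamma> ` ({x<..} \<inter> {c..d}))"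
      using G by (intro emeasure_restrict_space) auto
    also have "\<dots> = emeasure ?M (\<gamma> ` {m..d})"
    proof (cases "x < c")
      case True
      then have "{x<..} \<inter> {c..d} = {m..d}" by (auto simp: m_def)
      then show ?thesis by simp
    next
      case False
      then have "{x<..} \<inter> {c..d} = {m<..d}" by (auto simp: m_def)
      then show ?thesis using emeasure_half_open[of m d] m by (cases "m \<le> d") simp_all
    qed
    finally have nu: "emeasure \<nu> {x<..} = emeasure ?M (\<gamma> ` {m..d})" .
    then show "emeasure \<nu> {x<..} < \<infinity>" using length_finite[of m d] m by simp
    have "emeasure (density lborel \<sigma>) {x<..} = (\<integral>\<^sup>+t. \<sigma> t * indicator {x<..} t \<partial>lborel)"
      by (rule emeasure_density) auto
    also have "\<dots> = (\<integral>\<^sup>+t\<in>{m..d}. ennreal (norm (\<gamma>' t)) \<partial>lborel)"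
    proof (rule nn_integral_cong_AE)
      have "AE t in lborel. t \<noteq> x" by (rule AE_lborel_singleton)
      then show "AE t in lborel. \<sigma> t * indicator {x<..} t = ennreal (norm (\<gamma>' t)) * indicator {m..d} t"
        by eventually_elim (auto simp: \<sigma>_eq m_def indicator_def)
    qed
    finally show "emeasure \<nu> {x<..} = emeasure (density lborel \<sigma>) {x<..}"
      using nu length_eq_nn_integral[of m d] m by simp
  qed (auto simp: \<nu>_def)
  \<comment> \<open>Nothing is known of \<gamma> outside \<open>{c..d}\<close>; clamping the
    parameter gives a function that is measurable on the whole line and agrees with
    \<open>h (\<gamma> t)\<close> on the interval.\<close>
  define k where "k t = h (\<gamma> (max c (min d t)))" for t
  have "continuous_on UNIV (\<lambda>t. \<gamma> (max c (min d t)))"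
    using le by (intro continuous_on_compose2[OF cont] continuous_intros) auto
  then have [measurable]: "(\<lambda>t. \<gamma> (max c (min d t))) \<in> borel_measurable borel"
    by (rule borel_measurable_continuous_onI)
  have [measurable]: "k \<in> borel_measurable borel" unfolding k_def by measurable
  have k: "k t = h (\<gamma> t)" if "t \<in> {c..d}" for t using that by (simp add: k_def)
  have "(\<integral>\<^sup>+p\<in>?G. h p \<partial>?M) = (\<integral>\<^sup>+q. h q \<partial>restrict_space ?M ?G)"
    using G by (subst nn_integral_restrict_space) auto
  also have "\<dots> = (\<integral>\<^sup>+q. k (p q) \<partial>restrict_space ?M ?G)"
    by (intro nn_integral_cong) (auto simp: space_restrict_space p k)
  also have "\<dots> = (\<integral>\<^sup>+t. k t \<partial>\<nu>)" unfolding \<nu>_def by (rule nn_integral_distr[symmetric]) auto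
  also have "\<dots> = (\<integral>\<^sup>+t. \<sigma> t * k t \<partial>lborel)" unfolding eq by (rule nn_integral_density) auto
  also have "\<dots> = (\<integral>\<^sup>+t\<in>{c..d}. h (\<gamma> t) * ennreal (norm (\<gamma>' t)) \<partial>lborel)"
    by (intro nn_integral_cong) (auto simp: \<sigma>_eq k indicator_def mult.commute)
  finally show ?thesis .
qed

end

section \<open>The heat kernel along the grim reaper\<close>

abbreviation reaper_height :: "real \<Rightarrow> real" where
  "reaper_height x \<equiv> - ln (cos x)"

text \<open>The integrand of \<open>F_functional\<close> in the parameter x, for centre (a, b) and
  scale t. The factor 1 / cos x is the length element sqrt (1 + tan^2 x).\<close>

definition reaper_kernel :: "real \<Rightarrow> real \<Rightarrow> real \<Rightarrow> real \<Rightarrow> real" where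
  "reaper_kernel a b t x =
     exp (- ((x - a)\<^sup>2 + (reaper_height x - b)\<^sup>2) / (4 * t)) / (sqrt (4 * pi * t) * cos x)"

lemma cos_pos: "\<bar>x\<bar> < pi / 2 \<Longrightarrow> 0 < cos x"
  by (intro cos_gt_zero_pi) auto

lemma cos_pos_interval: "c < pi / 2 \<Longrightarrow> x \<in> {-c..c} \<Longrightarrow> 0 < cos x"
  by (rule cos_pos) auto

lemma cos_nonzero_interval: "c < pi / 2 \<Longrightarrow> \<forall>x\<in>{-c..c}. cos x \<noteq> 0"
  using cos_pos_interval by fastforce

lemma continuous_on_reaper_kernel:
  "c < pi / 2 \<Longrightarrow> 0 < t \<Longrightarrow> continuous_on {-c..c} (reaper_kernel a b t)"
  unfolding reaper_kernel_def
  using cos_pos_interval[of c] cos_nonzero_interval[of c]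
  by (intro continuous_intros) auto

lemma reaper_kernel_nonneg: "\<bar>x\<bar> < pi / 2 \<Longrightarrow> 0 < t \<Longrightarrow> 0 \<le> reaper_kernel a b t x"
  using cos_pos[of x] by (simp add: reaper_kernel_def)

lemma reaper_kernel_integrable:
  "c < pi / 2 \<Longrightarrow> 0 < t \<Longrightarrow> reaper_kernel a b t integrable_on {-c..c}"
  by (intro integrable_continuous_interval continuous_on_reaper_kernel)

lemma reaper_height_deriv:
  "\<bar>x\<bar> < pi / 2 \<Longrightarrow> (reaper_height has_real_derivative tan x) (at x within S)"
  using cos_pos[of x] by (auto intro!: derivative_eq_intros simp: tan_def)

text \<open>Substituting \<open>y = - ln (cos x)\<close>, for which \<open>dy = tan x dx\<close>.\<close>

lemma nn_integral_normal_density_reaper_height: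
  assumes c: "0 \<le> c" "c < pi / 2"
  shows "(\<integral>\<^sup>+x\<in>{0..c}. ennreal (normal_density \<mu> \<sigma> (reaper_height x) * tan x) \<partial>lborel) =
    (\<integral>\<^sup>+y\<in>{0..reaper_height c}. ennreal (normal_density \<mu> \<sigma> y) \<partial>lborel)"
proof -
  have "(\<integral>\<^sup>+y. normal_density \<mu> \<sigma> y * indicator {reaper_height 0..reaper_height c} y \<partial>lborel) =
     (\<integral>\<^sup>+x. normal_density \<mu> \<sigma> (reaper_height x) * tan x * indicator {0..c} x \<partial>lborel)"
  proof (rule nn_integral_substitution)
    show "continuous_on {0..c} tan"
      using c cos_nonzero_interval[of c] by (intro continuous_intros) auto
    show "0 \<le> tan x" if "x \<in> {0..c}" for x
      using that c by (auto intro: tan_pos_pi2_le)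
  qed (use c in \<open>auto intro!: reaper_height_deriv simp: set_borel_measurable_def\<close>)
  then show ?thesis by (simp add: ennreal_mult'' ennreal_indicator)
qed

text \<open>The one-dimensional heat kernel at scale t is the normal density of variance 2 t, which
  explains the deviation \<open>sqrt (2 * t)\<close> below.\<close>

lemma normal_density_sqrt:
  "0 < t \<Longrightarrow> normal_density \<mu> (sqrt (2 * t)) y = exp (- (y - \<mu>)\<^sup>2 / (4 * t)) / sqrt (4 * pi * t)"
  by (simp add: normal_density_def mult_ac)

text \<open>The splitting \<open>sec x = tan x + cos x / (1 + sin x)\<close> of the length element.\<close>

lemma reaper_kernel_le:
  assumes x: "0 \<le> x" "x < pi / 2" and t: "0 < t"
  shows "reaper_kernel a b t x \<le>
    normal_density b (sqrt (2 * t)) (reaper_height x) * tan x + 1 / sqrt (4 * pi * t)"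
proof -
  have c: "0 < cos x" and s: "0 \<le> sin x" using x cos_pos[of x] by (auto intro: sin_ge_zero)
  let ?E = "exp (- ((x - a)\<^sup>2 + (reaper_height x - b)\<^sup>2) / (4 * t))"
  have "1 / cos x = tan x + cos x / (1 + sin x)"
    using c s sin_cos_squared_add[of x]
    by (simp add: tan_def field_simps add_nonneg_eq_0_iff power2_eq_square)
  moreover have "cos x / (1 + sin x) \<le> 1" using s order_trans[OF cos_le_one[of x], of "1 + sin x"] by (simp add: divide_le_eq)
  ultimately have "1 / cos x \<le> tan x + 1" by simp
  moreover have "reaper_kernel a b t x = ?E / sqrt (4 * pi * t) * (1 / cos x)"
    by (simp add: reaper_kernel_def)
  moreover have "0 \<le> ?E / sqrt (4 * pi * t)" using t by simp
  ultimately have "reaper_kernel a b t x \<le> ?E / sqrt (4 * pi * t) * (tan x + 1)"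
    by (metis mult_left_mono)
  also have "\<dots> = ?E / sqrt (4 * pi * t) * tan x + ?E / sqrt (4 * pi * t)" by (simp add: distrib_left)
  also have "\<dots> \<le> normal_density b (sqrt (2 * t)) (reaper_height x) * tan x + 1 / sqrt (4 * pi * t)"
  proof (intro add_mono mult_right_mono)
    show "?E / sqrt (4 * pi * t) \<le> normal_density b (sqrt (2 * t)) (reaper_height x)"
      using t unfolding normal_density_sqrt[OF t] by (intro divide_right_mono) (simp_all add: diff_divide_distrib)
    show "?E / sqrt (4 * pi * t) \<le> 1 / sqrt (4 * pi * t)"
    proof (rule divide_right_mono)
      have "0 \<le> ((x - a)\<^sup>2 + (reaper_height x - b)\<^sup>2) / (4 * t)" using t by simp
      then show "?E \<le> 1" by (simp only: exp_le_one_iff minus_divide_left[symmetric] neg_le_0_iff_le)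
    qed (use t in simp)
    show "0 \<le> tan x" using c s by (simp add: tan_def)
  qed
  finally show ?thesis .
qed

lemma reaper_kernel_half_integral_le:
  assumes c: "0 \<le> c" "c < pi / 2" and t: "0 < t"
  shows "integral {0..c} (reaper_kernel a b t) \<le> 1 + c / sqrt (4 * pi * t)"
proof -
  let ?n = "\<lambda>x. normal_density b (sqrt (2 * t)) (reaper_height x) * tan x"
  have int: "?n integrable_on {0..c}"
    using c t cos_pos_interval[of c] cos_nonzero_interval[of c] unfolding normal_density_def
    by (intro integrable_continuous_interval continuous_intros) auto
  have nonneg: "0 \<le> ?n x" if "x \<in> {0..c}" for x
    using that c by (auto intro!: mult_nonneg_nonneg tan_pos_pi2_le)
  have "ennreal (integral {0..c} ?n) = (\<integral>\<^sup>+x\<in>{0..c}. ennreal (?n x) \<partial>lborel)"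
    using nn_integral_has_integral_lebesgue'[OF nonneg integrable_integral[OF int]] by simp
  also have "\<dots> = (\<integral>\<^sup>+y\<in>{0..reaper_height c}. ennreal (normal_density b (sqrt (2 * t)) y) \<partial>lborel)"
    by (rule nn_integral_normal_density_reaper_height[OF c])
  also have "\<dots> \<le> (\<integral>\<^sup>+y. ennreal (normal_density b (sqrt (2 * t)) y) \<partial>lborel)"
    by (intro nn_integral_mono) (simp add: indicator_def)
  also have "\<dots> = 1" using t by (subst nn_integral_eq_integral) auto
  finally have "integral {0..c} ?n \<le> 1" by simp
  moreover have "integral {0..c} (reaper_kernel a b t) \<le> integral {0..c} (\<lambda>x. ?n x + 1 / sqrt (4 * pi * t))"
    using c t int
    by (intro integral_le integrable_add integrable_const_ivl reaper_kernel_le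
        integrable_subinterval_real[OF reaper_kernel_integrable[OF c(2) t]]) auto
  moreover have "integral {0..c} (\<lambda>x. ?n x + 1 / sqrt (4 * pi * t)) = integral {0..c} ?n + c / sqrt (4 * pi * t)"
    using int c by (subst integral_add) (auto intro: integrable_const_ivl)
  ultimately show ?thesis by simp
qed

text \<open>The height is an even function, so reflecting the left half moves the centre (a, b) to
  (-a, b). Bounds on the right half for every \<open>a\<close> therefore cover both halves.\<close>

lemma reaper_kernel_integral_split:
  assumes c: "0 \<le> c" "c < pi / 2" and t: "0 < t"
  shows "integral {-c..c} (reaper_kernel a b t) =
    integral {0..c} (reaper_kernel (-a) b t) + integral {0..c} (reaper_kernel a b t)"
proof -
  have "integral {-c..c} (reaper_kernel a b t) =
      integral {-c..0} (reaper_kernel a b t) + integral {0..c} (reaper_kernel a b t)"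
    using c t by (intro Henstock_Kurzweil_Integration.integral_combine[symmetric] reaper_kernel_integrable) auto
  also have "integral {-c..0} (reaper_kernel a b t) = integral {0..c} (\<lambda>x. reaper_kernel a b t (-x))"
    using Henstock_Kurzweil_Integration.integral_reflect_real[of c 0 "\<lambda>x. reaper_kernel a b t (-x)"] by simp
  also have "(\<lambda>x. reaper_kernel a b t (-x)) = reaper_kernel (-a) b t"
    by (simp add: fun_eq_iff reaper_kernel_def power2_commute[of a] power2_eq_square algebra_simps)
  finally show ?thesis .
qed

lemma reaper_kernel_integral_le:
  assumes c: "0 \<le> c" "c < pi / 2" and t: "0 < t"
  shows "integral {-c..c} (reaper_kernel a b t) \<le> 2 + pi / sqrt (4 * pi * t)"
proof -
  have "integral {-c..c} (reaper_kernel a b t) \<le> 2 + 2 * (c / sqrt (4 * pi * t))"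
    using reaper_kernel_half_integral_le[OF assms, of a b] reaper_kernel_half_integral_le[OF assms, of "-a" b]
    by (simp add: reaper_kernel_integral_split[OF assms])
  also have "\<dots> \<le> 2 + pi / sqrt (4 * pi * t)"
    using c t by (simp add: divide_right_mono)
  finally show ?thesis .
qed

section \<open>Monotonicity formula on compact arcs\<close>

text \<open>With \<open>X\<close> the point of the curve minus the centre and \<open>T\<close> the unit tangent, the flux is
  \<open>(X \<bullet> T / (2 t) + e\<^sub>2 \<bullet> T) * \<rho>\<close>, where \<open>\<rho>\<close> is the heat kernel weight per unit length.\<close>

definition reaper_flux :: "real \<Rightarrow> real \<Rightarrow> real \<Rightarrow> real \<Rightarrow> real" where
  "reaper_flux a b t x = (((x - a) * cos x + (reaper_height x - b) * sin x) / (2 * t) + sin x) *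
     (cos x * reaper_kernel a b t x)"

text \<open>The sum of the partial derivatives of the kernel in \<open>b\<close> and
  \<open>t\<close>: the rate of change when centre and scale move up together.\<close>

definition reaper_kernel_deriv :: "real \<Rightarrow> real \<Rightarrow> real \<Rightarrow> real \<Rightarrow> real" where
  "reaper_kernel_deriv a b t x = reaper_kernel a b t x *
     (- 1 / (2 * t) + ((x - a)\<^sup>2 + (reaper_height x - b)\<^sup>2) / (4 * t\<^sup>2) + (reaper_height x - b) / (2 * t))"

text \<open>In x the tangent T = (cos x, sin x) turns at unit rate towards the normal (- sin x, cos
  x). The first two terms come from differentiating the factors X \<bullet> T / (2 t) and e_2
  \<bullet> T, the last from the Gaussian.\<close>

definition reaper_flux_deriv :: "real \<Rightarrow> real \<Rightarrow> real \<Rightarrow> real \<Rightarrow> real" where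
  "reaper_flux_deriv a b t x = reaper_kernel a b t x *
     ((1 + cos x * ((reaper_height x - b) * cos x - (x - a) * sin x)) / (2 * t) + (cos x)\<^sup>2 -
      (((x - a) * cos x + (reaper_height x - b) * sin x) / (2 * t) + sin x) *
      (((x - a) * cos x + (reaper_height x - b) * sin x) / (2 * t)))"

lemma reaper_kernel_has_deriv:
  assumes "- t < s"
  shows "((\<lambda>s. reaper_kernel a (b + s) (t + s) x) has_real_derivative
    reaper_kernel_deriv a (b + s) (t + s) x) (at s within S)"
\<comment> \<open>If cos x = 0, kernel and derivative are both constantly 0 by division by zero, so
  the formula holds there too.\<close>
proof (cases "cos x = 0")
  case False
  define Q where "Q s = (x - a)\<^sup>2 + (reaper_height x - (b + s))\<^sup>2" for s
  define \<tau> where "\<tau> = t + s"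
  have \<tau>: "0 < \<tau>" using assms by (simp add: \<tau>_def)
  have r: "sqrt (4 * pi * \<tau>) * sqrt (4 * pi * \<tau>) = 4 * pi * \<tau>" "0 < sqrt (4 * pi * \<tau>)" using \<tau> by auto
  have "((\<lambda>s. - Q s / (4 * (t + s))) has_real_derivative
      Q s / (4 * \<tau>\<^sup>2) + (reaper_height x - (b + s)) / (2 * \<tau>)) (at s within S)"
    unfolding Q_def \<tau>_def using \<tau>[unfolded \<tau>_def]
    by (auto intro!: derivative_eq_intros) (simp add: divide_simps, simp add: algebra_simps power2_eq_square)
  then have 1: "((\<lambda>s. exp (- Q s / (4 * (t + s)))) has_real_derivative
      exp (- Q s / (4 * \<tau>)) * (Q s / (4 * \<tau>\<^sup>2) + (reaper_height x - (b + s)) / (2 * \<tau>))) (at s within S)"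
    unfolding \<tau>_def by (rule DERIV_chain2[OF DERIV_exp])
  have 2: "((\<lambda>s. sqrt (4 * pi * (t + s))) has_real_derivative sqrt (4 * pi * \<tau>) / (2 * \<tau>)) (at s within S)"
    using \<tau> r unfolding \<tau>_def by (auto intro!: derivative_eq_intros simp: field_simps)
  have "((\<lambda>s. exp (- Q s / (4 * (t + s))) / (sqrt (4 * pi * (t + s)) * cos x)) has_real_derivative
     ((exp (- Q s / (4 * \<tau>)) * (Q s / (4 * \<tau>\<^sup>2) + (reaper_height x - (b + s)) / (2 * \<tau>))) * (sqrt (4 * pi * (t + s)) * cos x) -
     exp (- Q s / (4 * (t + s))) * (sqrt (4 * pi * \<tau>) / (2 * \<tau>) * cos x)) /
     ((sqrt (4 * pi * (t + s)) * cos x) * (sqrt (4 * pi * (t + s)) * cos x))) (at s within S)"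
    using False r by (intro DERIV_divide 1 2 DERIV_cmult_right) (auto simp: \<tau>_def)
  also have "((exp (- Q s / (4 * \<tau>)) * (Q s / (4 * \<tau>\<^sup>2) + (reaper_height x - (b + s)) / (2 * \<tau>))) * (sqrt (4 * pi * (t + s)) * cos x) -
     exp (- Q s / (4 * (t + s))) * (sqrt (4 * pi * \<tau>) / (2 * \<tau>) * cos x)) /
     ((sqrt (4 * pi * (t + s)) * cos x) * (sqrt (4 * pi * (t + s)) * cos x)) = reaper_kernel_deriv a (b + s) (t + s) x"
    unfolding reaper_kernel_deriv_def reaper_kernel_def \<tau>_def[symmetric] Q_def[symmetric]
    using False r(2) \<tau> by (simp add: divide_simps) (simp add: algebra_simps)
  finally show ?thesis by (simp add: reaper_kernel_def Q_def)
qed (simp add: reaper_kernel_def reaper_kernel_deriv_def)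

lemma reaper_flux_has_deriv:
  assumes x: "\<bar>x\<bar> < pi / 2" and t: "0 < t"
  shows "(reaper_flux a b t has_real_derivative reaper_flux_deriv a b t x) (at x)"
proof -
  \<comment> \<open>The bare Gaussian: the cosine in the flux cancels the secant in the kernel. The
    two expressions agree near \<open>x\<close>, where cosines stay positive, so the derivative
    transfers.\<close>
  let ?E = "\<lambda>x. exp (- ((x - a)\<^sup>2 + (reaper_height x - b)\<^sup>2) / (4 * t)) / sqrt (4 * pi * t)"
  let ?q = "reaper_height x - b"
  have c: "0 < cos x" using x by (rule cos_pos)
  have sq: "sin x * sin x = 1 - cos x * cos x"
    using sin_cos_squared_add[of x] by (simp add: power2_eq_square)
  have r: "0 < sqrt (4 * pi * t)" using t by simp
  note h = reaper_height_deriv[OF x]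
  have "((\<lambda>x. - ((x - a)\<^sup>2 + (reaper_height x - b)\<^sup>2) / (4 * t)) has_real_derivative
      - (((x - a) + ?q * tan x) / (2 * t))) (at x)"
    using t c by (auto intro!: derivative_eq_intros simp: tan_def field_simps)
  from DERIV_cdivide[OF DERIV_chain2[OF DERIV_exp this], where c="sqrt (4 * pi * t)"]
  have 1: "(?E has_real_derivative - ?E x * (((x - a) + ?q * tan x) / (2 * t))) (at x)"
    by (simp add: mult.commute)
  have 2: "((\<lambda>x. ((x - a) * cos x + (reaper_height x - b) * sin x) / (2 * t) + sin x) has_real_derivative
      (cos x - (x - a) * sin x + tan x * sin x + ?q * cos x) / (2 * t) + cos x) (at x)"
    using t c by (auto intro!: derivative_eq_intros simp: tan_def field_simps)
  have "((\<lambda>x. (((x - a) * cos x + (reaper_height x - b) * sin x) / (2 * t) + sin x) * ?E x) has_real_derivative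
     ((cos x - (x - a) * sin x + tan x * sin x + ?q * cos x) / (2 * t) + cos x) * ?E x +
     (- ?E x * (((x - a) + ?q * tan x) / (2 * t))) * (((x - a) * cos x + ?q * sin x) / (2 * t) + sin x)) (at x)"
    by (rule DERIV_mult[OF 2 1])
  also have "((cos x - (x - a) * sin x + tan x * sin x + ?q * cos x) / (2 * t) + cos x) * ?E x +
     (- ?E x * (((x - a) + ?q * tan x) / (2 * t))) * (((x - a) * cos x + ?q * sin x) / (2 * t) + sin x) =
     reaper_flux_deriv a b t x"
  proof -
    have E: "?E x = cos x * reaper_kernel a b t x" using c by (simp add: reaper_kernel_def)
    define k where "k = reaper_kernel a b t x"
    define q where "q = ?q"
    have A: "cos x * (cos x - (x - a) * sin x + tan x * sin x + q * cos x) = 1 + cos x * (q * cos x - (x - a) * sin x)"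
      using c sq by (simp add: tan_def algebra_simps)
    have B: "cos x * ((x - a) + q * tan x) = (x - a) * cos x + q * sin x"
      using c by (simp add: tan_def algebra_simps)
    have factor: "(A / (2 * t) + C) * (C * k) + (- (C * k) * (P / (2 * t))) * W =
        k * (C * A / (2 * t) + C\<^sup>2 - W * (C * P / (2 * t)))" for A C P W
      by (simp add: algebra_simps power2_eq_square)
    show ?thesis
      unfolding E unfolding reaper_flux_deriv_def q_def[symmetric] k_def[symmetric] factor A B ..
  qed
  finally show ?thesis
  proof (rule has_field_derivative_transform_within)
    show "0 < pi / 2 - \<bar>x\<bar>" using x by simp
  next
    show "(((y - a) * cos y + (reaper_height y - b) * sin y) / (2 * t) + sin y) * ?E y = reaper_flux a b t y"
      if "dist y x < pi / 2 - \<bar>x\<bar>" for y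
    proof -
      have "\<bar>y\<bar> < pi / 2" using that by (auto simp: dist_real_def)
      then show ?thesis using cos_pos[of y] by (simp add: reaper_flux_def reaper_kernel_def)
    qed
  qed (use x in auto)
qed

text \<open>This is Huisken's monotonicity formula: for a curve moving by its curvature, the rate of change
  of the heat kernel integrand is a perfect square up to a divergence.\<close>

lemma reaper_kernel_deriv_eq:
  assumes "0 < t"
  shows "reaper_kernel_deriv a b t x = reaper_kernel a b t x *
    (((reaper_height x - b) * cos x - (x - a) * sin x) / (2 * t) + cos x)\<^sup>2 - reaper_flux_deriv a b t x"
proof -
  define k p q C S where "k = reaper_kernel a b t x" and "p = x - a" and "q = reaper_height x - b"
    and "C = cos x" and "S = sin x"
  have CS: "C\<^sup>2 + S\<^sup>2 = 1" by (simp add: C_def S_def)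
  \<comment> \<open>With \<open>u\<close> for 1 / (2 t) the claim is a polynomial identity modulo
    C^2 + S^2 = 1. The squared term is the normal part of X / (2 t) + e_2.\<close>
  define u where "u = 1 / (2 * t)"
  have u: "z / (2 * t) = z * u" "z / (4 * t\<^sup>2) = z * u\<^sup>2" for z
    by (simp_all add: u_def power2_eq_square)
  have "- u + (p\<^sup>2 + q\<^sup>2) * u\<^sup>2 + q * u = ((q * C - p * S) * u + C)\<^sup>2 -
     ((1 + C * (q * C - p * S)) * u + C\<^sup>2 - ((p * C + q * S) * u + S) * ((p * C + q * S) * u))"
    using CS by algebra
  then show ?thesis
    unfolding reaper_kernel_deriv_def reaper_flux_deriv_def k_def[symmetric] p_def[symmetric]
      q_def[symmetric]
    unfolding C_def[symmetric] S_def[symmetric] u right_diff_distrib[symmetric] by simp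
qed

lemma continuous_on_reaper_kernel_deriv:
  assumes c: "c < pi / 2"
  shows "continuous_on ({- t<..} \<times> {-c..c}) (\<lambda>(s, x). reaper_kernel_deriv a (b + s) (t + s) x)"
proof -
  have "\<forall>z\<in>{- t<..} \<times> {-c..c}. 0 < cos (snd z) \<and> 0 < t + fst z"
    using cos_pos_interval[OF c] by (auto simp: less_diff_eq)
  then have "\<forall>z\<in>{- t<..} \<times> {-c..c}. cos (snd z) \<noteq> 0"
    "\<forall>z\<in>{- t<..} \<times> {-c..c}. t + fst z \<noteq> 0" "\<forall>z\<in>{- t<..} \<times> {-c..c}. 0 < t + fst z"
    by (auto simp: less_le)
  then show ?thesis
    unfolding reaper_kernel_deriv_def reaper_kernel_def split_beta
    by (intro continuous_intros) auto
qed

text \<open>On a compact arc, joint continuity of the derivative justifies differentiating under the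
  integral; \<open>- t < s\<close> keeps the scale positive.\<close>

lemma reaper_integral_has_deriv:
  assumes c: "c < pi / 2" and s: "- t < s"
  shows "((\<lambda>s. integral {-c..c} (reaper_kernel a (b + s) (t + s))) has_real_derivative
    integral {-c..c} (reaper_kernel_deriv a (b + s) (t + s))) (at s)"
proof -
  have "((\<lambda>s. integral (cbox (-c) c) (reaper_kernel a (b + s) (t + s))) has_real_derivative
    integral (cbox (-c) c) (reaper_kernel_deriv a (b + s) (t + s))) (at s within {- t<..})"
  proof (rule leibniz_rule_field_derivative)
    show "continuous_on ({- t<..} \<times> cbox (- c) c) (\<lambda>(s, x). reaper_kernel_deriv a (b + s) (t + s) x)"
      using continuous_on_reaper_kernel_deriv[OF c] by simp
    show "reaper_kernel a (b + s) (t + s) integrable_on cbox (- c) c" if "s \<in> {- t<..}" for s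
      using reaper_kernel_integrable[OF c, of "t + s"] that by (simp add: less_diff_eq)
  qed (use s in \<open>auto intro: reaper_kernel_has_deriv\<close>)
  then show ?thesis using s by (simp add: at_within_open[of s "{- t<..}"])
qed

text \<open>The integrand plus the flux derivative is the kernel times a square, hence nonnegative,
  and the flux derivative integrates to boundary values.\<close>

lemma reaper_kernel_deriv_integral_ge:
  assumes c: "0 \<le> c" "c < pi / 2" and t: "0 < t"
  shows "reaper_flux a b t (-c) - reaper_flux a b t c \<le> integral {-c..c} (reaper_kernel_deriv a b t)"
proof -
  have flux: "(reaper_flux_deriv a b t has_integral (reaper_flux a b t c - reaper_flux a b t (-c))) {-c..c}"
    using c t by (intro fundamental_theorem_of_calculus)
      (auto intro!: has_field_derivative_at_within[OF reaper_flux_has_deriv]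
        simp: has_real_derivative_iff_has_vector_derivative[symmetric])
  have "continuous_on {-c..c} (\<lambda>x. (\<lambda>(s, x). reaper_kernel_deriv a (b + s) (t + s) x) (0, x))"
    using t by (intro continuous_on_compose2[OF continuous_on_reaper_kernel_deriv[OF c(2)]] continuous_intros) auto
  then have "reaper_kernel_deriv a b t integrable_on {-c..c}"
    by (intro integrable_continuous_interval) simp
  note has_integral_add[OF integrable_integral[OF this] flux]
  moreover have "0 \<le> reaper_kernel_deriv a b t x + reaper_flux_deriv a b t x" if "x \<in> {-c..c}" for x
  proof -
    have "\<bar>x\<bar> < pi / 2" using that c by auto
    then show ?thesis using t by (simp add: reaper_kernel_deriv_eq reaper_kernel_nonneg)
  qed
  ultimately show ?thesis by (auto dest!: has_integral_nonneg)
qed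

text \<open>With R the distance to the centre, the bracket in the flux grows at most linearly in R,
  while exp (-z) \<le> 1/z bounds the Gaussian by 4 T / R^2. The product is of order 1/R, uniformly
  for scales in [t0, T], so it vanishes up the ends.\<close>

lemma abs_reaper_flux_le:
  assumes x: "\<bar>x\<bar> < pi / 2" and t: "0 < t0" "t0 \<le> t" "t \<le> T" and r: "1 \<le> r" "r \<le> reaper_height x - b"
  shows "\<bar>reaper_flux a b t x\<bar> \<le> (1 / (2 * t0) + 1) * (4 * T) / sqrt (4 * pi * t0) / r"
proof -
  define p q C S where "p = x - a" and "q = reaper_height x - b" and "C = cos x" and "S = sin x"
  define R where "R = sqrt (p\<^sup>2 + q\<^sup>2)"
  have R2: "R\<^sup>2 = p\<^sup>2 + q\<^sup>2" by (simp add: R_def)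
  have "q \<le> R" unfolding R_def by (simp add: real_le_rsqrt)
  then have R: "r \<le> R" "1 \<le> R" "0 < R" using r by (auto simp: q_def)
  have CS: "C\<^sup>2 + S\<^sup>2 = 1" by (simp add: C_def S_def)
  \<comment> \<open>Pythagoras in the orthonormal frame of tangent and normal, so the tangential
    component is at most R.\<close>
  have "(p * C + q * S)\<^sup>2 + (q * C - p * S)\<^sup>2 = R\<^sup>2" using CS unfolding R2 by algebra
  then have "(p * C + q * S)\<^sup>2 \<le> R\<^sup>2" by (metis le_add_same_cancel1 zero_le_power2)
  then have T: "\<bar>p * C + q * S\<bar> \<le> R" using R by (simp add: abs_le_square_iff[symmetric])
  have k: "cos x * reaper_kernel a b t x = exp (- R\<^sup>2 / (4 * t)) / sqrt (4 * pi * t)"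
    using cos_pos[OF x] by (simp add: reaper_kernel_def R2 p_def q_def)
  have "\<bar>(p * C + q * S) / (2 * t) + S\<bar> \<le> \<bar>p * C + q * S\<bar> / (2 * t) + \<bar>S\<bar>"
    using t abs_triangle_ineq[of "(p * C + q * S) / (2 * t)" S] by simp
  also have "\<dots> \<le> R / (2 * t0) + 1"
    using T t R by (intro add_mono frac_le) (auto simp: S_def)
  also have "\<dots> \<le> (1 / (2 * t0) + 1) * R" using R by (simp add: distrib_right)
  finally have 1: "\<bar>(p * C + q * S) / (2 * t) + S\<bar> \<le> (1 / (2 * t0) + 1) * R" .
  have "exp (- R\<^sup>2 / (4 * t)) \<le> 1 / (R\<^sup>2 / (4 * t))"
  proof -
    have "R\<^sup>2 / (4 * t) \<le> exp (R\<^sup>2 / (4 * t))"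
      using exp_ge_add_one_self[of "R\<^sup>2 / (4 * t)"] by linarith
    moreover have "0 < R\<^sup>2 / (4 * t)" using t R by simp
    ultimately have "1 / exp (R\<^sup>2 / (4 * t)) \<le> 1 / (R\<^sup>2 / (4 * t))" by (intro frac_le) auto
    then show ?thesis by (simp add: exp_minus inverse_eq_divide)
  qed
  also have "\<dots> \<le> 4 * T / R\<^sup>2" using t R by (simp add: divide_right_mono)
  finally have "exp (- R\<^sup>2 / (4 * t)) / sqrt (4 * pi * t) \<le> (4 * T / R\<^sup>2) / sqrt (4 * pi * t0)"
    using t by (intro frac_le) auto
  then have "\<bar>reaper_flux a b t x\<bar> \<le> ((1 / (2 * t0) + 1) * R) * ((4 * T / R\<^sup>2) / sqrt (4 * pi * t0))"
    unfolding reaper_flux_def k abs_mult using 1 t R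
    by (intro mult_mono) (auto simp: p_def q_def C_def S_def)
  also have "\<dots> = (1 / (2 * t0) + 1) * (4 * T) / sqrt (4 * pi * t0) / R"
    using R by (simp add: power2_eq_square)
  also have "\<dots> \<le> (1 / (2 * t0) + 1) * (4 * T) / sqrt (4 * pi * t0) / r"
    using t r R by (intro divide_left_mono) auto
  finally show ?thesis .
qed

section \<open>The sharp upper bound on compact arcs\<close>

lemma reaper_height_inverse:
  assumes "0 < y"
  shows "0 < arccos (exp (- y))" "arccos (exp (- y)) < pi / 2" "reaper_height (arccos (exp (- y))) = y"
proof -
  have e: "0 < exp (- y)" "exp (- y) < 1" using assms by auto
  then have e1: "- 1 \<le> exp (- y)" by linarith
  with e show "0 < arccos (exp (- y))" using arccos_less_arccos[of "exp (- y)" 1] by simp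
  show "arccos (exp (- y)) < pi / 2" using arccos_less_arccos[of 0 "exp (- y)"] e by simp
  show "reaper_height (arccos (exp (- y))) = y" using e e1 by (simp add: cos_arccos)
qed

lemma reaper_height_mono:
  assumes "0 \<le> x" "x \<le> y" "y < pi / 2"
  shows "reaper_height x \<le> reaper_height y"
proof -
  have "0 < cos y" using assms by (intro cos_pos) auto
  moreover have "cos y \<le> cos x" using assms by (intro cos_monotone_0_pi_le) auto
  ultimately show ?thesis by simp
qed

text \<open>On a sufficiently enlarged arc the integral loses at most \<open>e\<close> while the
  scale grows from \<open>t\<close> to \<open>t + S\<close>, where the fixed-scale estimate applies.
  Letting \<open>e\<close> tend to 0 and then \<open>S\<close> to infinity leaves 2.\<close>

lemma reaper_integral_le_2:
  assumes c: "0 \<le> c" "c < pi / 2" and t: "0 < t"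
  shows "integral {-c..c} (reaper_kernel a b t) \<le> 2"
proof -
  have main: "integral {-c..c} (reaper_kernel a b t) \<le> 2 + pi / sqrt (4 * pi * (t + S))" if S: "0 < S" for S
  proof (rule field_le_epsilon)
    fix e :: real assume e: "0 < e"
    \<comment> \<open>\<open>K\<close> is the constant of \<open>abs_reaper_flux_le\<close> for
      scales between \<open>t\<close> and \<open>t + S\<close>. Then \<open>r\<close> makes the
      total flux through both ends at most \<open>e\<close> over a time \<open>S\<close>, and
      \<open>y\<close> places the ends at least \<open>r\<close> above the highest centre,
      \<open>b + S\<close>.\<close>
    define K where "K = (1 / (2 * t) + 1) * (4 * (t + S)) / sqrt (4 * pi * t)"
    define r where "r = max 1 (2 * K * S / e)"
    define y where "y = max 1 (b + S + r)"
    define c' where "c' = max c (arccos (exp (- y)))"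
    have K: "0 < K" using t S by (simp add: K_def add_pos_pos)
    have r: "1 \<le> r" "2 * K / r * S \<le> e"
      using K S e by (auto simp: r_def max_def field_simps)
    have y: "0 < y" "b + S + r \<le> y" by (auto simp: y_def)
    note inv = reaper_height_inverse[OF y(1)]
    have c': "0 \<le> c'" "c' < pi / 2" "c \<le> c'" using c inv by (auto simp: c'_def)
    have "y \<le> reaper_height c'"
      using reaper_height_mono[of "arccos (exp (- y))" c'] inv c' by (simp add: c'_def)
    then have height: "r \<le> reaper_height c' - (b + s)" if "s \<le> S" for s using y(2) that by simp
    define J where "J s = integral {-c'..c'} (reaper_kernel a (b + s) (t + s))" for s
    \<comment> \<open>The derivative of \<open>J\<close> can be negative only through the flux at
      the two ends, at most \<open>K / r\<close> each; the linear term compensates for this.\<close>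
    have "J 0 + 2 * K / r * 0 \<le> J S + 2 * K / r * S"
    proof (rule DERIV_nonneg_imp_nondecreasing[where f="\<lambda>s. J s + 2 * K / r * s"])
      fix s assume s: "0 \<le> s" "s \<le> S"
      let ?D = "integral {-c'..c'} (reaper_kernel_deriv a (b + s) (t + s)) + 2 * K / r"
      have "((\<lambda>s. J s + 2 * K / r * s) has_real_derivative ?D) (at s)"
        unfolding J_def using s t r(1) reaper_integral_has_deriv[OF c'(2), of t s a b]
        by (auto intro!: derivative_eq_intros)
      moreover have "\<bar>reaper_flux a (b + s) (t + s) z\<bar> \<le> K / r" if "z = c' \<or> z = -c'" for z
        unfolding K_def using that c' s t r(1) height[OF s(2)] by (intro abs_reaper_flux_le) auto
      then have "\<bar>reaper_flux a (b + s) (t + s) c'\<bar> \<le> K / r" "\<bar>reaper_flux a (b + s) (t + s) (-c')\<bar> \<le> K / r"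
        by auto
      then have "0 \<le> ?D"
        using reaper_kernel_deriv_integral_ge[OF c'(1,2), of "t + s" a "b + s"] s t by simp
      ultimately show "\<exists>D. ((\<lambda>s. J s + 2 * K / r * s) has_real_derivative D) (at s) \<and> 0 \<le> D" by blast
    qed (use S in simp)
    moreover have "integral {-c..c} (reaper_kernel a b t) \<le> J 0"
      unfolding J_def using c' t
      by (simp, intro integral_subset_le reaper_kernel_integrable)
        (use c c' t in \<open>auto intro!: reaper_kernel_nonneg\<close>)
    moreover have "J S \<le> 2 + pi / sqrt (4 * pi * (t + S))"
      unfolding J_def using c' t S by (intro reaper_kernel_integral_le) auto
    ultimately show "integral {-c..c} (reaper_kernel a b t) \<le> 2 + pi / sqrt (4 * pi * (t + S)) + e"
      using r(2) by simp
  qed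
  have "((\<lambda>S. 2 + pi / sqrt (4 * pi * (t + S))) \<longlongrightarrow> 2) at_top" using t by real_asymp
  then show ?thesis
  proof (rule tendsto_lowerbound)
    show "\<forall>\<^sub>F S in at_top. integral {-c..c} (reaper_kernel a b t) \<le> 2 + pi / sqrt (4 * pi * (t + S))"
      using eventually_gt_at_top[of 0] by eventually_elim (rule main)
  qed simp
qed

section \<open>The lower bound from centres on the axis\<close>

text \<open>Chebyshev's inequality: the distribution has mean \<open>t\<close> and variance \<open>2 t\<close>.\<close>

lemma normal_density_central_mass:
  assumes t: "0 < t"
  shows "ennreal (1 - 2 / t) \<le> (\<integral>\<^sup>+y\<in>{0..2 * t}. ennreal (normal_density t (sqrt (2 * t)) y) \<partial>lborel)"
proof -
  let ?n = "normal_density t (sqrt (2 * t))"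
  have \<sigma>: "0 < sqrt (2 * t)" using t by simp
  have b: "has_bochner_integral lborel (\<lambda>y. ?n y * (y - t)\<^sup>2) (2 * t)"
    using normal_moment_even[OF \<sigma>, of t 1] t by (simp add: fact_numeral)
  have b0: "has_bochner_integral lborel ?n 1"
    using \<sigma> by (simp add: has_bochner_integral_iff)
  \<comment> \<open>The parabola 1 - (y - t)^2 / t^2 lies below the indicator of [0, 2 t], being at
    most 1 inside and negative outside; its integral against the density is 1 - 2/t.\<close>
  have d: "has_bochner_integral lborel (\<lambda>y. ?n y - ?n y * (y - t)\<^sup>2 / t\<^sup>2) (1 - 2 * t / t\<^sup>2)"
    by (intro has_bochner_integral_diff has_bochner_integral_divide b b0)
  have i: "integrable lborel (\<lambda>y. ?n y * indicator {0..2 * t} y)"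
    using \<sigma> by (intro integrable_mult_indicator[of _ _ ?n, simplified, unfolded mult.commute[of "indicator _ _"]]) auto
  have le: "?n y - ?n y * (y - t)\<^sup>2 / t\<^sup>2 \<le> ?n y * indicator {0..2 * t} y" for y
  proof (cases "y \<in> {0..2 * t}")
    case False
    then have "t < \<bar>y - t\<bar>" using t by auto
    then have "t\<^sup>2 \<le> (y - t)\<^sup>2" using t by (metis abs_le_square_iff abs_of_pos less_imp_le)
    then have "1 \<le> (y - t)\<^sup>2 / t\<^sup>2" using t by simp
    then have "?n y * 1 \<le> ?n y * ((y - t)\<^sup>2 / t\<^sup>2)" by (intro mult_left_mono) auto
    then show ?thesis using False by simp
  qed simp
  have "1 - 2 / t = (\<integral>y. ?n y - ?n y * (y - t)\<^sup>2 / t\<^sup>2 \<partial>lborel)"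
    using d t by (simp add: has_bochner_integral_iff power2_eq_square)
  also have "\<dots> \<le> (\<integral>y. ?n y * indicator {0..2 * t} y \<partial>lborel)"
    using d i le by (intro integral_mono) (auto simp: has_bochner_integral_iff)
  finally have "ennreal (1 - 2 / t) \<le> ennreal (\<integral>y. ?n y * indicator {0..2 * t} y \<partial>lborel)"
    by (rule ennreal_leI)
  also have "\<dots> = (\<integral>\<^sup>+y. ennreal (?n y * indicator {0..2 * t} y) \<partial>lborel)"
    using i by (intro nn_integral_eq_integral[symmetric]) auto
  also have "\<dots> = (\<integral>\<^sup>+y\<in>{0..2 * t}. ennreal (?n y) \<partial>lborel)"
    by (simp add: ennreal_mult' ennreal_indicator)
  finally show ?thesis .
qed

text \<open>The arc is cut at height 2 t, symmetrically about the height t of the centre. The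
  horizontal offset is below pi/2 and costs at most the factor exp (-(pi/2)^2 / (4 t)); with sec x
  \<ge> tan x, each half then dominates the central normal mass.\<close>

lemma reaper_integral_ge:
  assumes t: "0 < t"
  defines "c \<equiv> arccos (exp (- (2 * t)))"
  shows "2 * exp (- pi\<^sup>2 / (16 * t)) * (1 - 2 / t) \<le> integral {-c..c} (reaper_kernel 0 t t)"
proof -
  have c: "0 \<le> c" "c < pi / 2" "reaper_height c = 2 * t"
    using reaper_height_inverse[of "2 * t"] t by (auto simp: c_def)
  let ?n = "\<lambda>x. normal_density t (sqrt (2 * t)) (reaper_height x) * tan x"
  have cont: "continuous_on {0..c} ?n"
    using c t cos_pos_interval[of c] cos_nonzero_interval[of c] unfolding normal_density_def
    by (intro continuous_intros) auto
  have int: "?n integrable_on {0..c}" using cont by (rule integrable_continuous_interval)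
  have nonneg: "0 \<le> ?n x" if "x \<in> {0..c}" for x
    using that c by (auto intro!: mult_nonneg_nonneg tan_pos_pi2_le)
  have "ennreal (1 - 2 / t) \<le> (\<integral>\<^sup>+x\<in>{0..c}. ennreal (?n x) \<partial>lborel)"
    using normal_density_central_mass[OF t]
    unfolding nn_integral_normal_density_reaper_height[OF c(1,2)] c(3) .
  also have "\<dots> = ennreal (integral {0..c} ?n)"
    using nn_integral_has_integral_lebesgue'[OF nonneg integrable_integral[OF int]] by simp
  \<comment> \<open>For t < 2 the \<open>ennreal\<close> on the left is truncated to 0, and the real
    inequality rests on the integral being nonnegative.\<close>
  finally have mass: "1 - 2 / t \<le> integral {0..c} ?n"
    using integral_nonneg[OF int nonneg] by (simp add: ennreal_le_iff)
  have "exp (- pi\<^sup>2 / (16 * t)) * (1 - 2 / t) \<le> exp (- pi\<^sup>2 / (16 * t)) * integral {0..c} ?n"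
    using mass by (intro mult_left_mono) auto
  also have "\<dots> = integral {0..c} (\<lambda>x. exp (- pi\<^sup>2 / (16 * t)) * ?n x)" by simp
  also have "\<dots> \<le> integral {0..c} (reaper_kernel 0 t t)"
  proof (rule integral_le)
    show "(\<lambda>x. exp (- pi\<^sup>2 / (16 * t)) * ?n x) integrable_on {0..c}" 
      by (intro integrable_continuous_interval continuous_on_mult continuous_on_const cont)
    show "reaper_kernel 0 t t integrable_on {0..c}"
      using c t by (intro integrable_subinterval_real[OF reaper_kernel_integrable[OF c(2) t]]) auto
    fix x assume x: "x \<in> {0..c}"
    then have x': "0 \<le> x" "x < pi / 2" using c by auto
    then have cx: "0 < cos x" by (intro cos_pos) auto
    have "x\<^sup>2 \<le> (pi / 2)\<^sup>2" using x' by (intro power_mono) auto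
    then have "- pi\<^sup>2 / (16 * t) \<le> - x\<^sup>2 / (4 * t)" using t by (simp add: field_simps)
    then have "exp (- pi\<^sup>2 / (16 * t)) * exp (- (reaper_height x - t)\<^sup>2 / (4 * t)) \<le>
        exp (- (x\<^sup>2 + (reaper_height x - t)\<^sup>2) / (4 * t))"
      by (simp add: exp_add[symmetric] diff_divide_distrib)
    moreover have "tan x \<le> 1 / cos x" using cx by (simp add: tan_def divide_right_mono)
    moreover have "0 \<le> tan x" using x' by (rule tan_pos_pi2_le)
    ultimately have "exp (- pi\<^sup>2 / (16 * t)) * exp (- (reaper_height x - t)\<^sup>2 / (4 * t)) * tan x \<le>
        exp (- (x\<^sup>2 + (reaper_height x - t)\<^sup>2) / (4 * t)) * (1 / cos x)"
      by (intro mult_mono) auto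
    then have "exp (- pi\<^sup>2 / (16 * t)) * exp (- (reaper_height x - t)\<^sup>2 / (4 * t)) * tan x / sqrt (4 * pi * t) \<le>
        exp (- (x\<^sup>2 + (reaper_height x - t)\<^sup>2) / (4 * t)) * (1 / cos x) / sqrt (4 * pi * t)"
      using t by (intro divide_right_mono) auto
    then show "exp (- pi\<^sup>2 / (16 * t)) * ?n x \<le> reaper_kernel 0 t t x"
      using t by (simp add: reaper_kernel_def normal_density_def mult_ac)
  qed
  finally have "exp (- pi\<^sup>2 / (16 * t)) * (1 - 2 / t) \<le> integral {0..c} (reaper_kernel 0 t t)" .
  then show ?thesis using reaper_kernel_integral_split[OF c(1,2) t, of 0 t] by simp
qed

section \<open>The entropy of the grim reaper\<close>

definition reaper_curve :: "real \<Rightarrow> real ^ 2" where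
  "reaper_curve x = vector [x, reaper_height x]"

lemma reaper_curve_nth [simp]: "reaper_curve x $ 1 = x" "reaper_curve x $ 2 = reaper_height x"
  by (simp_all add: reaper_curve_def)

lemma grim_reaper_eq: "grim_reaper = reaper_curve ` {- pi / 2<..<pi / 2}"
  by (auto simp: grim_reaper_def reaper_curve_def)

lemma smooth_arc_reaper:
  assumes c: "0 \<le> c" "c < pi / 2"
  shows "smooth_arc reaper_curve (\<lambda>x. vector [1, tan x]) (- c) c"
proof
  show "- c \<le> c" using c by simp
  show "inj_on reaper_curve {- c..c}" by (rule inj_onI) (metis reaper_curve_nth(1))
  \<comment> \<open>As a combination of constant vectors, the curve comes under the rules for
    derivatives and continuity of scalar multiples.\<close>
  have v: "(vector [p, q] :: real ^ 2) = p *\<^sub>R vector [1, 0] + q *\<^sub>R vector [0, 1]" for p q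
    by (simp add: vec_eq_iff forall_2)
  show "(reaper_curve has_vector_derivative vector [1, tan x]) (at x within {- c..c})" if "x \<in> {- c..c}" for x
  proof -
    have "\<bar>x\<bar> < pi / 2" using that c by auto
    then have "((\<lambda>x. x *\<^sub>R vector [1, 0] + reaper_height x *\<^sub>R vector [0, 1] :: real ^ 2) has_vector_derivative
        (x *\<^sub>R 0 + 1 *\<^sub>R vector [1, 0]) + (reaper_height x *\<^sub>R 0 + tan x *\<^sub>R vector [0, 1]))
        (at x within {- c..c})"
      by (intro has_vector_derivative_add has_vector_derivative_scaleR has_vector_derivative_const
          DERIV_ident reaper_height_deriv)
    then show ?thesis
      unfolding reaper_curve_def v[of _ "reaper_height _"] v[of _ "tan _"] by simp
  qed
  show "continuous_on {- c..c} (\<lambda>x. vector [1, tan x] :: real ^ 2)"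
    unfolding v[of _ "tan _"] using cos_nonzero_interval[OF c(2)] by (intro continuous_intros) auto
qed

lemma norm_reaper_curve_deriv:
  assumes "\<bar>x\<bar> < pi / 2"
  shows "norm (vector [1, tan x] :: real ^ 2) = 1 / cos x"
proof -
  have c: "0 < cos x" using assms by (rule cos_pos)
  have "norm (vector [1, tan x] :: real ^ 2) = sqrt (1 + (tan x)\<^sup>2)"
    by (simp add: norm_vec_def L2_set_def sum_2)
  also have "1 + (tan x)\<^sup>2 = (1 / cos x)\<^sup>2"
    using tan_sec[of x] c by (simp add: inverse_eq_divide)
  finally show ?thesis using c by simp
qed

lemma F_functional_reaper_arc:
  assumes c: "0 \<le> c" "c < pi / 2" and t: "0 < t"
  shows "F_functional z t (reaper_curve ` {- c..c}) =
    ennreal (integral {- c..c} (reaper_kernel (z $ 1) (z $ 2) t))"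
proof -
  interpret smooth_arc reaper_curve "\<lambda>x. vector [1, tan x]" "- c" c
    using c by (rule smooth_arc_reaper)
  let ?k = "(4 * pi * t) powr (- 1 / 2)"
  have k: "?k = 1 / sqrt (4 * pi * t)"
    using t by (simp add: powr_minus_divide powr_half_sqrt)
  have eq: "ennreal ?k * ennreal (exp (- (norm (reaper_curve x - z))\<^sup>2 / (4 * t))) *
      ennreal (norm (vector [1, tan x] :: real ^ 2)) = ennreal (reaper_kernel (z $ 1) (z $ 2) t x)"
    if "x \<in> {- c..c}" for x
  proof -
    have x: "\<bar>x\<bar> < pi / 2" using that c by auto
    have "(norm (reaper_curve x - z))\<^sup>2 = (x - z $ 1)\<^sup>2 + (reaper_height x - z $ 2)\<^sup>2"
      unfolding power2_norm_eq_inner by (simp add: inner_vec_def sum_2 power2_eq_square)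
    then show ?thesis
      unfolding norm_reaper_curve_deriv[OF x] k using t cos_pos[OF x]
      by (simp add: reaper_kernel_def ennreal_mult[symmetric])
  qed
  let ?G = "reaper_curve ` {- c..c}"
  have [measurable]: "?G \<in> sets borel" by (rule image_borel) auto
  have "F_functional z t ?G =
      (\<integral>\<^sup>+x\<in>?G. ennreal ?k * ennreal (exp (- (norm (x - z))\<^sup>2 / (4 * t))) \<partial>hausdorff_measure 1)"
    unfolding F_functional_def Let_def mult.assoc
    by (subst nn_integral_cmult) simp_all
  also have "\<dots> = (\<integral>\<^sup>+x\<in>{- c..c}. ennreal ?k *
      ennreal (exp (- (norm (reaper_curve x - z))\<^sup>2 / (4 * t))) *
      ennreal (norm (vector [1, tan x] :: real ^ 2)) \<partial>lborel)"
    by (rule nn_integral_arc) measurable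
  also have "\<dots> = (\<integral>\<^sup>+x\<in>{- c..c}. ennreal (reaper_kernel (z $ 1) (z $ 2) t x) \<partial>lborel)"
    by (rule nn_integral_cong, rename_tac x, case_tac "x \<in> {- c..c}")
      (simp_all only: eq indicator_simps mult_zero_right not_False_eq_True)
  also have "\<dots> = ennreal (integral {- c..c} (reaper_kernel (z $ 1) (z $ 2) t))"
    using c t by (intro nn_integral_has_integral_lebesgue' integrable_integral reaper_kernel_integrable
        reaper_kernel_nonneg) auto
  finally show ?thesis .
qed

lemma F_functional_mono: "A \<subseteq> B \<Longrightarrow> F_functional z t A \<le> F_functional z t B"
  unfolding F_functional_def Let_def
  by (intro mult_left_mono nn_integral_mono) (auto simp: indicator_def)

text \<open>Up to a constant, \<open>F_functional z t\<close> is the measure with Gaussian density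
  against Hausdorff measure, hence continuous from below. This extends the bound from compact arcs
  to the full curve.\<close>

lemma F_functional_incseq_UN:
  assumes A: "incseq A" "\<And>i. A i \<in> sets borel"
  shows "F_functional z t (\<Union>i::nat. A i) = (SUP i. F_functional z t (A i))"
proof -
  define n where "n = DIM('a) - 1"
  let ?f = "\<lambda>x::'a. ennreal (exp (- (norm (x - z))\<^sup>2 / (4 * t)))"
  let ?N = "density (hausdorff_measure n) ?f"
  let ?k = "ennreal ((4 * pi * t) powr (- real n / 2))"
  have F: "F_functional z t B = ?k * emeasure ?N B" if "B \<in> sets borel" for B
    unfolding F_functional_def Let_def n_def[symmetric] using that
    by (subst emeasure_density) auto
  have "F_functional z t (\<Union>i. A i) = ?k * emeasure ?N (\<Union>i. A i)"
    using A(2) by (intro F) auto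
  also have "emeasure ?N (\<Union>i. A i) = (SUP i. emeasure ?N (A i))"
    using A by (intro SUP_emeasure_incseq[symmetric]) auto
  also have "?k * \<dots> = (SUP i. ?k * emeasure ?N (A i))" by (rule SUP_mult_left_ennreal)
  finally show ?thesis unfolding F[OF A(2)] .
qed

lemma F_functional_grim_reaper_le:
  assumes t: "0 < t"
  shows "F_functional z t grim_reaper \<le> 2"
proof -
  \<comment> \<open>These endpoints increase to pi/2 without reaching it and start at 0, so each arc
    meets the conditions of the arc lemmas.\<close>
  define c where "c i = pi / 2 * (1 - 1 / (real i + 1))" for i :: nat
  have c: "0 \<le> c i" "c i < pi / 2" for i by (auto simp: c_def)
  have c_mono: "c i \<le> c j" if "i \<le> j" for i j
    using that by (auto simp: c_def intro!: mult_left_mono frac_le)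
  have "\<exists>i. x \<in> {- c i..c i}" if "\<bar>x\<bar> < pi / 2" for x
  proof -
    have "(\<lambda>i. pi / 2 * (1 - 1 / (real i + 1))) \<longlonglongrightarrow> pi / 2" by real_asymp
    then have "eventually (\<lambda>i. \<bar>x\<bar> < c i) sequentially"
      unfolding c_def[abs_def] using that by (rule order_tendstoD)
    then obtain i where "\<bar>x\<bar> < c i" by (auto simp: eventually_sequentially)
    then show ?thesis by (intro exI[of _ i]) auto
  qed
  then have "{- pi / 2<..<pi / 2} \<subseteq> (\<Union>i. {- c i..c i})" by (auto simp: abs_less_iff)
  moreover have "{- c i..c i} \<subseteq> {- pi / 2<..<pi / 2}" for i using c(2)[of i] by auto
  ultimately have "{- pi / 2<..<pi / 2} = (\<Union>i. {- c i..c i})" by (intro antisym UN_least)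
  then have eq: "grim_reaper = (\<Union>i. reaper_curve ` {- c i..c i})"
    unfolding grim_reaper_eq image_UN[symmetric] by (rule arg_cong)
  have "F_functional z t grim_reaper = (SUP i. F_functional z t (reaper_curve ` {- c i..c i}))"
    unfolding eq
  proof (rule F_functional_incseq_UN)
    show "incseq (\<lambda>i. reaper_curve ` {- c i..c i})"
    proof (intro monoI image_mono)
      fix i j :: nat assume "i \<le> j"
      then show "{- c i..c i} \<subseteq> {- c j..c j}" using c_mono[of i j] by simp
    qed
    show "reaper_curve ` {- c i..c i} \<in> sets borel" for i
      using smooth_arc.image_borel[OF smooth_arc_reaper[OF c]] by blast
  qed
  also have "\<dots> \<le> 2"
  proof (rule SUP_least)
    fix i
    have "ennreal (integral {- c i..c i} (reaper_kernel (z $ 1) (z $ 2) t)) \<le> ennreal 2"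
      by (intro ennreal_leI reaper_integral_le_2 c t)
    then show "F_functional z t (reaper_curve ` {- c i..c i}) \<le> 2"
      unfolding F_functional_reaper_arc[OF c t] by simp
  qed
  finally show ?thesis .
qed

theorem theorem1p3:
  shows "entropy grim_reaper = 2"
proof (rule antisym)
  show "entropy grim_reaper \<le> 2"
    unfolding entropy_def by (intro SUP_least F_functional_grim_reaper_le) simp
  \<comment> \<open>From below a compact arc suffices, since a larger set only increases the
    integral of a nonnegative weight.\<close>
  have "ennreal (2 * exp (- pi\<^sup>2 / (16 * t)) * (1 - 2 / t)) \<le> entropy grim_reaper" if t: "0 < t" for t
  proof -
    define c where "c = arccos (exp (- (2 * t)))"
    have c: "0 \<le> c" "c < pi / 2"
      using reaper_height_inverse[of "2 * t"] t by (auto simp: c_def)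
    define z :: "real ^ 2" where "z = vector [0, t]"
    have "ennreal (2 * exp (- pi\<^sup>2 / (16 * t)) * (1 - 2 / t)) \<le> F_functional z t (reaper_curve ` {- c..c})"
      unfolding F_functional_reaper_arc[OF c t]
      using reaper_integral_ge[OF t] by (intro ennreal_leI) (simp add: z_def c_def)
    also have "\<dots> \<le> F_functional z t grim_reaper"
      unfolding grim_reaper_eq using c by (intro F_functional_mono image_mono) auto
    also have "\<dots> \<le> entropy grim_reaper"
      unfolding entropy_def using t by (intro SUP_upper2[of z] SUP_upper) auto
    finally show ?thesis .
  qed
  then have "eventually (\<lambda>t. ennreal (2 * exp (- pi\<^sup>2 / (16 * t)) * (1 - 2 / t)) \<le> entropy grim_reaper) at_top"
    by (intro eventually_mono[OF eventually_gt_at_top[of 0]])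
  moreover have "((\<lambda>t. 2 * exp (- pi\<^sup>2 / (16 * t)) * (1 - 2 / t)) \<longlongrightarrow> 2) at_top" by real_asymp
  then have "((\<lambda>t. ennreal (2 * exp (- pi\<^sup>2 / (16 * t)) * (1 - 2 / t))) \<longlongrightarrow> ennreal 2) at_top"
    by (rule tendsto_ennrealI)
  ultimately have "ennreal 2 \<le> entropy grim_reaper"
    by (intro tendsto_upperbound[where F=at_top]) auto
  then show "2 \<le> entropy grim_reaper" by simp
qed

end
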